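(* Let $\{\omega_e\}_{e\in E}$ be i.i.d. weights on the edges of $K_{n,n}$ with $\psi(\beta)=\log \mathbb{E}e^{-\beta\omega_e}<\infty$ for all $\beta\in[0,\infty)$. Fix $\beta\in[0,\infty)$ and, given $\boldsymbol\omega$, let $\pi_1,\pi_2$ be independent samples from the Gibbs measure $\mathbb{P}_{\beta,\boldsymbol\omega}$ on perfect matchings of $K_{n,n}$. Then, as $n\to\infty$, the number $|\pi_1\cap\pi_2|$ of common edges of $\pi_1$ and $\pi_2$ converges to $\mathrm{Poisson}\left(e^{\psi(2\beta)-2\psi(\beta)}\right)$ in probability; that is, the (random) law of $|\pi_1\cap\pi_2|$ under $\mathbb{P}_{\beta,\boldsymbol\omega}\otimes\mathbb{P}_{\beta,\boldsymbol\omega}$ converges weakly to $\mathrm{Poisson}\left(e^{\psi(2\beta)-2\psi(\beta)}\right)$, in probability with respect to $\boldsymbol\omega$.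
   Context: $E$ is the edge set of $K_{n,n}$ and $\mathcal M$ is the set of all $n!$ perfect matchings of $K_{n,n}$ (each identified with its set of $n$ edges). The law of $\omega_e$ does not depend on $n$; $\boldsymbol\omega=(\omega_e)_{e\in E}$. The weights may be negative, and may equal $+\infty$ with positive probability (but not almost surely), with the convention $e^{-\beta\cdot(+\infty)}=0$ for every $\beta\ge 0$. For $\pi\in\mathcal M$, $W(\pi)=\sum_{e\in\pi}\omega_e$, and $$\mathbb{P}_{\beta,\boldsymbol\omega}(\pi)=\frac{1}{Z(\beta,\boldsymbol\omega)}\cdot\frac1{n!}e^{-\beta W(\pi)},\qquad Z(\beta,\boldsymbol\omega)=\frac1{n!}\sum_{\pi\in\mathcal M}e^{-\beta W(\pi)}.$$ If $Z(\beta,\boldsymbol\omega)=0$, the Gibbs measure is taken to be uniform on $\mathcal M$. *)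

theory Defs
  imports "HOL-Probability.Probability" "HOL-Combinatorics.Permutations"
begin

text \<open>The edge joining the \<open>i\<close>-th left vertex to the \<open>j\<close>-th right vertex of
  \<open>K\<^sub>n\<^sub>,\<^sub>n\<close> is the ordered pair \<open>(i, j)\<close>.\<close>

definition edges :: "nat \<Rightarrow> (nat \<times> nat) set" where
  "edges n = {..<n} \<times> {..<n}"

definition perfect_matchings :: "nat \<Rightarrow> (nat \<times> nat) set set" where
  "perfect_matchings n =
     {\<pi>. \<pi> \<subseteq> edges n \<and> (\<forall>i<n. \<exists>!j. (i, j) \<in> \<pi>) \<and> (\<forall>j<n. \<exists>!i. (i, j) \<in> \<pi>)}"

text \<open>\<open>boltzmann \<beta> w\<close> is \<open>e\<^sup>-\<^sup>\<beta>\<^sup>w\<close> for a weight \<open>w\<close> in \<open>(-\<infinity>, \<infinity>]\<close>, with value \<open>0\<close> at \<open>w = \<infinity>\<close>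
  also for \<open>\<beta> = 0\<close>. The value at \<open>-\<infinity>\<close> is immaterial: weights are almost surely not \<open>-\<infinity>\<close>.\<close>

definition boltzmann :: "real \<Rightarrow> ereal \<Rightarrow> real" where
  "boltzmann \<beta> w = (if w = \<infinity> then 0 else exp (- \<beta> * real_of_ereal w))"

definition log_mgf :: "ereal measure \<Rightarrow> real \<Rightarrow> real" where
  "log_mgf \<mu> \<beta> = ln (\<integral>w. boltzmann \<beta> w \<partial>\<mu>)"

definition total_weight :: "(nat \<times> nat \<Rightarrow> ereal) \<Rightarrow> (nat \<times> nat) set \<Rightarrow> ereal" where
  "total_weight w \<pi> = (\<Sum>e\<in>\<pi>. w e)"

definition partition_fun :: "nat \<Rightarrow> real \<Rightarrow> (nat \<times> nat \<Rightarrow> ereal) \<Rightarrow> real" where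
  "partition_fun n \<beta> w =
     1 / fact n * (\<Sum>\<pi>\<in>perfect_matchings n. boltzmann \<beta> (total_weight w \<pi>))"

text \<open>That \<open>embed_pmf\<close> is applied to a genuine probability mass function is \<open>pmf_gibbs\<close> below.\<close>

definition gibbs :: "nat \<Rightarrow> real \<Rightarrow> (nat \<times> nat \<Rightarrow> ereal) \<Rightarrow> (nat \<times> nat) set pmf" where
  "gibbs n \<beta> w =
     (if partition_fun n \<beta> w = 0 then pmf_of_set (perfect_matchings n)
      else embed_pmf (\<lambda>\<pi>. if \<pi> \<in> perfect_matchings n
             then 1 / partition_fun n \<beta> w * (1 / fact n * boltzmann \<beta> (total_weight w \<pi>))
             else 0))"

definition overlap_law :: "nat \<Rightarrow> real \<Rightarrow> (nat \<times> nat \<Rightarrow> ereal) \<Rightarrow> nat pmf" where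
  "overlap_law n \<beta> w =
     map_pmf (\<lambda>(\<pi>\<^sub>1, \<pi>\<^sub>2). card (\<pi>\<^sub>1 \<inter> \<pi>\<^sub>2)) (pair_pmf (gibbs n \<beta> w) (gibbs n \<beta> w))"

text \<open>Convergence in probability to a constant; the underlying probability space may depend on
  \<open>n\<close>. Measurability is demanded because \<open>measure\<close> is \<open>0\<close> on non-measurable sets.\<close>

definition conv_in_prob :: "(nat \<Rightarrow> 'a measure) \<Rightarrow> (nat \<Rightarrow> 'a \<Rightarrow> real) \<Rightarrow> real \<Rightarrow> bool" where
  "conv_in_prob M X c \<longleftrightarrow>
     (\<forall>n. X n \<in> borel_measurable (M n)) \<and>
     (\<forall>\<epsilon>>0. (\<lambda>n. measure (M n) {x \<in> space (M n). \<bar>X n x - c\<bar> > \<epsilon>}) \<longlonglongrightarrow> 0)"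

text \<open>Weak convergence in probability of random measures \<open>\<nu> n\<close> to a fixed measure \<open>\<nu>'\<close>. Finitely
  many bounded continuous test functions at a time describe the neighbourhoods of \<open>\<nu>'\<close> in the weak
  topology, so this says that \<open>\<nu> n\<close> lies in any given neighbourhood with probability tending to
  \<open>1\<close>.\<close>

definition weak_conv_in_prob ::
  "(nat \<Rightarrow> 'a measure) \<Rightarrow> (nat \<Rightarrow> 'a \<Rightarrow> 'b::topological_space measure) \<Rightarrow> 'b measure \<Rightarrow> bool" where
  "weak_conv_in_prob M \<nu> \<nu>' \<longleftrightarrow>
     (\<forall>f :: 'b \<Rightarrow> real. continuous_on UNIV f \<and> bounded (range f) \<longrightarrow>
        conv_in_prob M (\<lambda>n x. \<integral>k. f k \<partial>\<nu> n x) (\<integral>k. f k \<partial>\<nu>'))"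

lemma finite_perfect_matchings: "finite (perfect_matchings n)"
  by (rule finite_subset[of _ "Pow (edges n)"]) (auto simp: perfect_matchings_def edges_def)

lemma bij_betw_perfect_matchings:
  "bij_betw (\<lambda>p. (\<lambda>i. (i, p i)) ` {..<n}) {p. p permutes {..<n}} (perfect_matchings n)"
  (is "bij_betw ?g ?P _")
  unfolding bij_betw_def
proof (intro conjI equalityI subsetI)
  show "inj_on ?g ?P"
  proof (rule inj_onI, rule ext)
    fix p q i assume p: "p \<in> ?P" and q: "q \<in> ?P" and eq: "?g p = ?g q"
    show "p i = q i"
    proof (cases "i < n")
      case True
      then have "(i, p i) \<in> ?g q" unfolding eq[symmetric] by auto
      then show ?thesis by auto
    next
      case False
      then show ?thesis using p q by (auto simp: permutes_def)
    qed
  qed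
next
  fix \<pi> assume "\<pi> \<in> ?g ` ?P"
  then obtain p where p: "p permutes {..<n}" and \<pi>: "\<pi> = ?g p" by auto
  have mem: "(i, j) \<in> \<pi> \<longleftrightarrow> i < n \<and> j = p i" for i j unfolding \<pi> by auto
  have "p i < n \<longleftrightarrow> i < n" for i using permutes_in_image[OF p, of i] by simp
  moreover have "\<exists>!i. p i = j" for j using p by (auto simp: permutes_def)
  ultimately show "\<pi> \<in> perfect_matchings n"
    unfolding perfect_matchings_def edges_def by (auto simp: mem) metis+
next
  fix \<pi> assume \<pi>: "\<pi> \<in> perfect_matchings n"
  define p where "p i = (if i < n then THE j. (i, j) \<in> \<pi> else i)" for i
  have mem: "(i, j) \<in> \<pi> \<longleftrightarrow> i < n \<and> j = p i" for i j
  proof (cases "i < n")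
    case True
    then have ex: "\<exists>!j. (i, j) \<in> \<pi>" using \<pi> by (auto simp: perfect_matchings_def)
    then have "(i, p i) \<in> \<pi>" using theI'[OF ex] True by (simp add: p_def)
    then show ?thesis using ex True by auto
  next
    case False
    then show ?thesis using \<pi> by (auto simp: perfect_matchings_def edges_def)
  qed
  have lt: "p i < n" if "i < n" for i
    using \<pi> mem[of i "p i"] that by (auto simp: perfect_matchings_def edges_def)
  have un: "\<exists>!i. i < n \<and> j = p i" if "j < n" for j
  proof -
    have "\<exists>!i. (i, j) \<in> \<pi>" using \<pi> that by (simp add: perfect_matchings_def)
    then show ?thesis by (simp only: mem)
  qed
  have "inj_on p {..<n}" using un lt by (intro inj_onI) (metis lessThan_iff)
  moreover have "p ` {..<n} = {..<n}" 
  proof (intro equalityI subsetI)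
    fix j assume "j \<in> {..<n}"
    then have "\<exists>i. i < n \<and> j = p i" using un[of j] by auto
    then show "j \<in> p ` {..<n}" by auto
  qed (use lt in auto)
  ultimately have "p permutes {..<n}"
    by (intro bij_imp_permutes) (auto simp: bij_betw_def p_def)
  moreover have "\<pi> = ?g p" using mem by (auto simp: image_iff)
  ultimately show "\<pi> \<in> ?g ` ?P" by blast
qed

lemma card_perfect_matchings: "card (perfect_matchings n) = fact n"
  using bij_betw_same_card[OF bij_betw_perfect_matchings, of n] card_permutations[of "{..<n}" n]
  by simp

lemma perfect_matchings_nonempty: "perfect_matchings n \<noteq> {}"
  using card_perfect_matchings[of n] by auto

lemma partition_fun_nonneg: "0 \<le> partition_fun n \<beta> w"
  unfolding partition_fun_def boltzmann_def by (intro mult_nonneg_nonneg sum_nonneg) auto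

lemma pmf_gibbs:
  "pmf (gibbs n \<beta> w) \<pi> =
     (if \<pi> \<in> perfect_matchings n
      then if partition_fun n \<beta> w = 0 then 1 / fact n
           else 1 / partition_fun n \<beta> w * (1 / fact n * boltzmann \<beta> (total_weight w \<pi>))
      else 0)"
proof (cases "partition_fun n \<beta> w = 0")
  case True
  then show ?thesis
    by (simp add: gibbs_def finite_perfect_matchings perfect_matchings_nonempty
        card_perfect_matchings indicator_def)
next
  case False
  let ?f = "\<lambda>\<pi>. if \<pi> \<in> perfect_matchings n
     then 1 / partition_fun n \<beta> w * (1 / fact n * boltzmann \<beta> (total_weight w \<pi>)) else 0"
  have nn: "0 \<le> ?f \<pi>" for \<pi>
    using partition_fun_nonneg[of n \<beta> w] by (auto simp: boltzmann_def)
  have "(\<integral>\<^sup>+\<pi>. ennreal (?f \<pi>) \<partial>count_space UNIV) = (\<Sum>\<pi>\<in>perfect_matchings n. ennreal (?f \<pi>))"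
    by (rule nn_integral_count_space'[OF finite_perfect_matchings]) auto
  also have "\<dots> = ennreal (\<Sum>\<pi>\<in>perfect_matchings n. ?f \<pi>)"
    by (rule sum_ennreal) (rule nn)
  also have "(\<Sum>\<pi>\<in>perfect_matchings n. ?f \<pi>) = 1 / partition_fun n \<beta> w * partition_fun n \<beta> w"
    by (simp add: partition_fun_def sum_distrib_left cong: sum.cong)
  also have "\<dots> = 1" using False by simp
  finally have "(\<integral>\<^sup>+\<pi>. ennreal (?f \<pi>) \<partial>count_space UNIV) = 1" by simp
  from pmf_embed_pmf[of ?f, OF nn this] False show ?thesis
    by (simp add: gibbs_def)
qed

end

theory Submission
  imports Defs
begin

text \<open>
  Normalise \<open>Y\<^sub>e = e\<^sup>-\<^sup>\<beta>\<^sup>\<omega>\<^sup>e / \<bbbE> e\<^sup>-\<^sup>\<beta>\<^sup>\<omega>\<^sup>e\<close>, so that \<open>Y\<^sub>e\<close> has mean \<open>1\<close> and second moment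
  \<open>r = e\<^bsup>\<psi>(2\<beta>) - 2\<psi>(\<beta>)\<^esup>\<close>, and let \<open>Z\<close> be the average over \<open>\<pi>\<close> of \<open>\<Prod>\<^bsub>e\<in>\<pi>\<^esub> Y\<^sub>e\<close>. The product
  \<open>G = \<Prod>\<^sub>e (1 + (Y\<^sub>e - 1)/n)\<close> over all edges satisfies \<open>\<bbbE> G\<^sup>2 \<le> e\<^bsup>r-1\<^esup>\<close>, \<open>\<bbbE> ZG = (1 + (r-1)/n)\<^sup>n\<close> and
  \<open>\<bbbE> Z\<^sup>2 \<le> e\<^bsup>r-1\<^esup>\<close>, so \<open>Z - G \<rightarrow> 0\<close> in \<open>L\<^sup>2\<close>. As \<open>\<bbbE> 1/G\<close> is bounded, \<open>Z\<close> is bounded away from \<open>0\<close> in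
  probability. The same computation applies to the average \<open>Z\<^sub>T\<close> of \<open>\<Prod>\<^bsub>e\<in>\<pi>-T\<^esub> Y\<^sub>e\<close> over the \<open>\<pi>\<close> that extend a
  partial matching \<open>T\<close> of fixed size.

  The \<open>k\<close>-th factorial moment of \<open>|\<pi>\<^sub>1 \<inter> \<pi>\<^sub>2|\<close> under the Gibbs measure, multiplied by \<open>Z\<^sup>2\<close>, is the average
  over the partial matchings \<open>T\<close> of size \<open>k\<close> of \<open>(\<Prod>\<^bsub>e\<in>T\<^esub> Y\<^sub>e)\<^sup>2 Z\<^sub>T\<^sup>2\<close>. Replacing \<open>Z\<^sub>T\<close> by \<open>G\<close>, applying the
  law of large numbers to the average of \<open>(\<Prod>\<^bsub>e\<in>T\<^esub> Y\<^sub>e)\<^sup>2\<close> and replacing \<open>G\<close> by \<open>Z\<close> shows that it differs from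
  \<open>r\<^sup>k Z\<^sup>2\<close> by \<open>o(1)\<close> in \<open>L\<^sup>1\<close>. A bounded test function is a Newton series in the binomial coefficients of
  its argument; the tail of the series is controlled by the Gibbs mean of \<open>5\<^bsup>|\<pi>\<^sub>1 \<inter> \<pi>\<^sub>2|\<^esup>\<close>, whose
  product with \<open>Z\<^sup>2\<close> has expectation at most \<open>e\<^bsup>5r-1\<^esup>\<close>.
\<close>

section \<open>Perfect matchings extending a partial matching\<close>

lemma card_perfect_matching:
  assumes "\<pi> \<in> perfect_matchings n"
  shows "finite \<pi>" and "card \<pi> = n"
proof -
  obtain p where p: "\<pi> = (\<lambda>i. (i, p i)) ` {..<n}"
    using assms bij_betw_imp_surj_on[OF bij_betw_perfect_matchings, of n] by blast
  show "finite \<pi>" unfolding p by simp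
  show "card \<pi> = n" unfolding p by (subst card_image) (auto simp: inj_on_def)
qed

text \<open>A matching containing \<open>T\<close> is the graph of a permutation that agrees with
  \<open>p\<close> on \<open>A\<close>, the left endpoints of \<open>T\<close>. These permutations
  are \<open>p\<close> composed with the permutations of the complement of \<open>A\<close>, and
  \<open>A\<close> has as many elements as \<open>T\<close>.\<close>

lemma card_perfect_matchings_superset:
  assumes "\<pi> \<in> perfect_matchings n" and "T \<subseteq> \<pi>"
  shows "card {\<pi>' \<in> perfect_matchings n. T \<subseteq> \<pi>'} = fact (n - card T)"
proof -
  let ?g = "\<lambda>p. (\<lambda>i. (i, p i)) ` {..<n}"
  note bij = bij_betw_perfect_matchings[of n]
  obtain p where p: "p permutes {..<n}" and \<pi>: "\<pi> = ?g p"
    using assms(1) bij_betw_imp_surj_on[OF bij] by blast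
  define A where "A = fst ` T"
  have A: "A \<subseteq> {..<n}" using assms(2) by (auto simp: A_def \<pi>)
  have T: "T = (\<lambda>i. (i, p i)) ` A" using assms(2) by (force simp: A_def \<pi> image_iff)
  have cA: "card T = card A" unfolding T by (subst card_image) (auto simp: inj_on_def)
  let ?Q = "{q. q permutes {..<n} \<and> (\<forall>i\<in>A. q i = p i)}"
  have "{\<pi>' \<in> perfect_matchings n. T \<subseteq> \<pi>'} = ?g ` ?Q"
  proof (intro equalityI subsetI)
    fix \<pi>' assume *: "\<pi>' \<in> {\<pi>' \<in> perfect_matchings n. T \<subseteq> \<pi>'}"
    then obtain q where "q permutes {..<n}" "\<pi>' = ?g q"
      using bij_betw_imp_surj_on[OF bij] by blast
    moreover from this * have "\<forall>i\<in>A. q i = p i" by (auto simp: T)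
    ultimately show "\<pi>' \<in> ?g ` ?Q" by blast
  next
    fix \<pi>' assume "\<pi>' \<in> ?g ` ?Q"
    then obtain q where q: "q permutes {..<n}" "\<forall>i\<in>A. q i = p i" "\<pi>' = ?g q" by auto
    then have "\<pi>' \<in> perfect_matchings n" using bij_betw_imp_surj_on[OF bij] by blast
    then show "\<pi>' \<in> {\<pi>' \<in> perfect_matchings n. T \<subseteq> \<pi>'}" using q A by (auto simp: T)
  qed
  moreover have "inj_on ?g ?Q"
    using bij_betw_imp_inj_on[OF bij] by (rule inj_on_subset) auto
  ultimately have "card {\<pi>' \<in> perfect_matchings n. T \<subseteq> \<pi>'} = card ?Q"
    by (simp add: card_image)
  also have "?Q = (\<lambda>s. p \<circ> s) ` {s. s permutes {..<n} - A}"
  proof (intro equalityI subsetI)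
    fix q assume q: "q \<in> ?Q"
    have "inv p \<circ> q permutes {..<n}" using q p by (auto intro: permutes_compose permutes_inv)
    moreover have "(inv p \<circ> q) i = i" if "i \<in> A" for i
      using q that permutes_inverses[OF p] by auto
    ultimately have "inv p \<circ> q permutes {..<n} - A"
      by (auto simp: permutes_def)
    moreover have "q = p \<circ> (inv p \<circ> q)" using permutes_inverses[OF p] by auto
    ultimately show "q \<in> (\<lambda>s. p \<circ> s) ` {s. s permutes {..<n} - A}" by blast
  next
    fix q assume "q \<in> (\<lambda>s. p \<circ> s) ` {s. s permutes {..<n} - A}"
    then obtain s where s: "s permutes {..<n} - A" "q = p \<circ> s" by auto
    then show "q \<in> ?Q" using p permutes_subset[OF s(1), of "{..<n}"]
      by (auto intro: permutes_compose simp: permutes_not_in)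
  qed
  also have "card \<dots> = card {s. s permutes {..<n} - A}"
    by (rule card_image) (use p in \<open>auto simp: inj_on_def fun_eq_iff inj_eq[OF permutes_inj]\<close>)
  also have "\<dots> = fact (n - card T)"
    using A by (intro card_permutations) (auto simp: cA card_Diff_subset finite_subset)
  finally show ?thesis .
qed

text \<open>Encoding through an extension excludes no matching of size \<open>k\<close>, because the
  graph is complete bipartite. The extension serves as the base point from which all others are
  counted.\<close>

definition partial_matchings :: "nat \<Rightarrow> nat \<Rightarrow> (nat \<times> nat) set set" where
  "partial_matchings n k = {T. card T = k \<and> (\<exists>\<pi>\<in>perfect_matchings n. T \<subseteq> \<pi>)}"

lemma partial_matchings_subset_edges: "T \<in> partial_matchings n k \<Longrightarrow> T \<subseteq> edges n"
  by (auto simp: partial_matchings_def perfect_matchings_def)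

lemma finite_edges: "finite (edges n)"
  by (simp add: edges_def)

lemma finite_partial_matchings: "finite (partial_matchings n k)"
  by (rule finite_subset[of _ "Pow (edges n)"])
    (auto simp: finite_edges dest: partial_matchings_subset_edges)

text \<open>Double counting of the pairs of a partial matching \<open>T\<close> and a perfect
  matching containing it: every \<open>T\<close> of size \<open>k\<close> has
  \<open>fact (n - k)\<close> extensions.\<close>

lemma sum_perfect_matchings_subsets:
  fixes h :: "(nat \<times> nat) set \<Rightarrow> real"
  shows "(\<Sum>\<pi>\<in>perfect_matchings n. \<Sum>T | T \<subseteq> \<pi> \<and> card T = k. h T) =
    fact (n - k) * (\<Sum>T\<in>partial_matchings n k. h T)"
proof -
  have "(\<Sum>\<pi>\<in>perfect_matchings n. \<Sum>T | T \<subseteq> \<pi> \<and> card T = k. h T) =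
    (\<Sum>\<pi>\<in>perfect_matchings n. \<Sum>T\<in>{T\<in>partial_matchings n k. T \<subseteq> \<pi>}. h T)"
    by (intro sum.cong refl) (auto simp: partial_matchings_def)
  also have "\<dots> = (\<Sum>T\<in>partial_matchings n k. \<Sum>\<pi>\<in>{\<pi>\<in>perfect_matchings n. T \<subseteq> \<pi>}. h T)"
    by (rule sum.swap_restrict) (auto simp: finite_partial_matchings finite_perfect_matchings)
  also have "\<dots> = (\<Sum>T\<in>partial_matchings n k. fact (n - k) * h T)"
    by (intro sum.cong refl)
      (auto simp: partial_matchings_def card_perfect_matchings_superset)
  finally show ?thesis by (simp add: sum_distrib_left)
qed

lemma card_subsets_containing:
  assumes "finite A" "e \<in> A"
  shows "card {T. T \<subseteq> A \<and> card T = Suc k \<and> e \<in> T} = (card A - 1) choose k"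
proof -
  have "{T. T \<subseteq> A \<and> card T = Suc k \<and> e \<in> T} = insert e ` {T. T \<subseteq> A - {e} \<and> card T = k}"
  proof (intro equalityI subsetI)
    fix T assume T: "T \<in> {T. T \<subseteq> A \<and> card T = Suc k \<and> e \<in> T}"
    then have "T = insert e (T - {e})" "T - {e} \<subseteq> A - {e}" "card (T - {e}) = k" by auto
    then show "T \<in> insert e ` {T. T \<subseteq> A - {e} \<and> card T = k}" by blast
  next
    fix T assume "T \<in> insert e ` {T. T \<subseteq> A - {e} \<and> card T = k}"
    then obtain T' where "T' \<subseteq> A - {e}" "card T' = k" "T = insert e T'" by auto
    moreover from this have "finite T'" "e \<notin> T'" using assms by (auto intro: finite_subset)
    ultimately show "T \<in> {T. T \<subseteq> A \<and> card T = Suc k \<and> e \<in> T}" using assms by auto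
  qed
  also have "card \<dots> = card {T. T \<subseteq> A - {e} \<and> card T = k}"
    by (rule card_image) (auto simp: inj_on_def insert_eq_iff; blast)
  also have "\<dots> = (card A - 1) choose k" using assms by (subst n_subsets) auto
  finally show ?thesis .
qed

lemma card_partial_matchings:
  "fact (n - k) * real (card (partial_matchings n k)) = fact n * real (n choose k)"
  using sum_perfect_matchings_subsets[where n = n and k = k and h = "\<lambda>_. 1"]
  by (simp add: n_subsets card_perfect_matching card_perfect_matchings)

text \<open>Every edge lies in the same fraction k/n^2 of the partial matchings, so a fixed
  \<open>T'\<close> with \<open>k\<close> edges meets a uniform \<open>T\<close> in k^2/n^2 edges on
  average. This smallness gives the law of large numbers for \<open>weight_sq_avg\<close>.\<close>

lemma sum_card_Int_partial_matchings:
  assumes "0 < n" "T' \<in> partial_matchings n k"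
  shows "(\<Sum>T\<in>partial_matchings n k. real (card (T \<inter> T'))) =
    real k ^ 2 / real n ^ 2 * real (card (partial_matchings n k))"
proof (cases k)
  case 0
  have "card (T \<inter> T') = 0" for T
    using 0 assms(2) unfolding partial_matchings_def using card_perfect_matching(1)
    by (auto dest: finite_subset)
  then show ?thesis using 0 by simp
next
  case (Suc k')
  have finT': "finite T'"
    using partial_matchings_subset_edges[OF assms(2)] finite_edges by (rule finite_subset)
  have inner: "(\<Sum>T | T \<subseteq> \<pi> \<and> card T = k. of_bool (e \<in> T)) =
      (if e \<in> \<pi> then real ((n - 1) choose k') else 0)" if "\<pi> \<in> perfect_matchings n" for \<pi> e
  proof -
    have fin: "finite \<pi>" "card \<pi> = n" using card_perfect_matching that by auto
    have "(\<Sum>T | T \<subseteq> \<pi> \<and> card T = k. of_bool (e \<in> T)) =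
       real (card {T. T \<subseteq> \<pi> \<and> card T = k \<and> e \<in> T})"
      using fin by (simp add: of_bool_def sum.If_cases Int_def conj_assoc)
    also have "\<dots> = (if e \<in> \<pi> then real ((n - 1) choose k') else 0)"
      using fin card_subsets_containing[of \<pi> e k'] by (auto simp: Suc) 
    finally show ?thesis .
  qed
  \<comment> \<open>The number of \<open>T\<close> through one edge comes from double counting with
    the indicator of \<open>e \<in> T\<close>. The perfect matchings through \<open>e\<close> are
    the extensions of \<open>{e}\<close>.\<close>
  have e: "fact (n - k) * (\<Sum>T\<in>partial_matchings n k. of_bool (e \<in> T)) =
      fact (n - 1) * real ((n - 1) choose k')" if eT: "e \<in> T'" for e
  proof -
    obtain \<pi>0 where \<pi>0: "\<pi>0 \<in> perfect_matchings n" "{e} \<subseteq> \<pi>0"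
      using assms(2) eT by (auto simp: partial_matchings_def)
    have "fact (n - k) * (\<Sum>T\<in>partial_matchings n k. of_bool (e \<in> T)) =
       (\<Sum>\<pi>\<in>perfect_matchings n. \<Sum>T | T \<subseteq> \<pi> \<and> card T = k. of_bool (e \<in> T) :: real)"
      by (rule sum_perfect_matchings_subsets[symmetric])
    also have "\<dots> = (\<Sum>\<pi>\<in>perfect_matchings n. if e \<in> \<pi> then real ((n - 1) choose k') else 0)"
      by (intro sum.cong refl inner)
    also have "\<dots> = real (card {\<pi>\<in>perfect_matchings n. {e} \<subseteq> \<pi>}) * real ((n - 1) choose k')"
      by (simp add: sum.If_cases finite_perfect_matchings Int_def)
    also have "card {\<pi>\<in>perfect_matchings n. {e} \<subseteq> \<pi>} = fact (n - 1)"
      using card_perfect_matchings_superset[OF \<pi>0] by simp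
    finally show ?thesis by simp
  qed
  have "fact (n - k) * (\<Sum>T\<in>partial_matchings n k. real (card (T \<inter> T'))) =
      fact (n - k) * (\<Sum>T\<in>partial_matchings n k. \<Sum>e\<in>T'. of_bool (e \<in> T))"
    using finT' by (simp add: of_bool_def sum.If_cases Int_commute)
  also have "\<dots> = (\<Sum>e\<in>T'. fact (n - k) * (\<Sum>T\<in>partial_matchings n k. of_bool (e \<in> T)))"
    by (subst sum.swap) (simp add: sum_distrib_left)
  also have "\<dots> = real k * (fact (n - 1) * real ((n - 1) choose k'))"
    using assms(2) by (subst sum.cong[OF refl e]) (auto simp: partial_matchings_def)
  also have "\<dots> = real k ^ 2 / real n ^ 2 * (fact n * real (n choose k))"
  proof -
    obtain n' where n': "n = Suc n'" using assms(1) by (cases n) auto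
    have "real (Suc k') * real (Suc n' choose Suc k') = real (Suc n') * real (n' choose k')"
      using Suc_times_binomial[of k' n'] by (metis of_nat_mult)
    then have "real k * real (n choose k) = real n * real (n' choose k')" using Suc n' by simp
    moreover have "fact n = real n * fact n'" using n' by simp
    ultimately have "real k ^ 2 * (fact n * real (n choose k)) =
       real n ^ 2 * (real k * (fact n' * real (n' choose k')))"
      by (simp add: power2_eq_square algebra_simps)
    then show ?thesis using assms(1) n' by (simp add: field_simps)
  qed
  also have "\<dots> = fact (n - k) * (real k ^ 2 / real n ^ 2 * real (card (partial_matchings n k)))"
    by (simp add: card_partial_matchings[symmetric])
  finally show ?thesis by (subst (asm) mult_left_cancel) simp_all
qed

lemma sum_Pow_card:
  fixes h :: "nat \<Rightarrow> real"
  assumes "finite A"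
  shows "(\<Sum>T\<in>Pow A. h (card T)) = (\<Sum>j\<le>card A. real (card A choose j) * h j)"
proof -
  have "(\<Sum>T\<in>Pow A. h (card T)) = (\<Sum>j\<in>{..card A}. \<Sum>T\<in>{T \<in> Pow A. card T = j}. h (card T))"
    by (rule sum.group[symmetric]) (use assms in \<open>auto intro: card_mono\<close>)
  also have "\<dots> = (\<Sum>j\<le>card A. real (card {T. T \<subseteq> A \<and> card T = j}) * h j)"
    by (intro sum.cong refl) (auto intro: sum.cong)
  also have "\<dots> = (\<Sum>j\<le>card A. real (card A choose j) * h j)"
    using assms by (simp add: n_subsets)
  finally show ?thesis .
qed

text \<open>Expanding the power of 1 + t as a sum of \<open>t ^ card S\<close> over subsets
  \<open>S\<close> of the overlap turns the sum over \<pi>' into counts of extensions of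
  \<open>T \<union> S\<close>. The counts \<open>fact (m - j)\<close> and the binomials combine to
  \<open>fact m / fact j\<close>, which leaves a partial sum of the exponential series.\<close>

lemma sum_perfect_matchings_power_overlap_le:
  fixes t :: real
  assumes \<pi>: "\<pi> \<in> perfect_matchings n" "T \<subseteq> \<pi>" and t: "0 \<le> t"
  shows "(\<Sum>\<pi>'\<in>{\<pi>'\<in>perfect_matchings n. T \<subseteq> \<pi>'}. (1 + t) ^ card (\<pi> \<inter> \<pi>' - T))
    \<le> fact (n - card T) * exp t"
proof -
  define k m where "k = card T" and "m = n - k"
  have fin: "finite \<pi>" "card \<pi> = n" "finite T" using card_perfect_matching \<pi> by (auto intro: finite_subset)
  have m: "card (\<pi> - T) = m" using fin \<pi>(2) by (simp add: card_Diff_subset m_def k_def)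
  let ?P = "{\<pi>'\<in>perfect_matchings n. T \<subseteq> \<pi>'}"
  have "(\<Sum>\<pi>'\<in>?P. (1 + t) ^ card (\<pi> \<inter> \<pi>' - T)) =
     (\<Sum>\<pi>'\<in>?P. \<Sum>S\<in>{S\<in>Pow (\<pi> - T). S \<subseteq> \<pi>'}. t ^ card S)"
  proof (intro sum.cong refl)
    fix \<pi>' assume "\<pi>' \<in> ?P"
    have "{S\<in>Pow (\<pi> - T). S \<subseteq> \<pi>'} = Pow (\<pi> \<inter> \<pi>' - T)" by auto
    then show "(1 + t) ^ card (\<pi> \<inter> \<pi>' - T) = (\<Sum>S\<in>{S\<in>Pow (\<pi> - T). S \<subseteq> \<pi>'}. t ^ card S)"
      using fin binomial_ring[of t 1 "card (\<pi> \<inter> \<pi>' - T)"]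
      by (simp add: sum_Pow_card add.commute)
  qed
  also have "\<dots> = (\<Sum>S\<in>Pow (\<pi> - T). \<Sum>\<pi>'\<in>{\<pi>'\<in>?P. S \<subseteq> \<pi>'}. t ^ card S)"
    by (rule sum.swap_restrict) (use fin in \<open>auto simp: finite_perfect_matchings\<close>)
  also have "\<dots> = (\<Sum>S\<in>Pow (\<pi> - T). fact (m - card S) * t ^ card S)"
  proof (intro sum.cong refl)
    fix S assume S: "S \<in> Pow (\<pi> - T)"
    then have "card (T \<union> S) = k + card S"
      using fin by (subst card_Un_disjoint) (auto simp: k_def intro: finite_subset)
    moreover have "{\<pi>'\<in>?P. S \<subseteq> \<pi>'} = {\<pi>'\<in>perfect_matchings n. T \<union> S \<subseteq> \<pi>'}" by auto
    ultimately show "(\<Sum>\<pi>'\<in>{\<pi>'\<in>?P. S \<subseteq> \<pi>'}. t ^ card S) = fact (m - card S) * t ^ card S"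
      using card_perfect_matchings_superset[OF \<pi>(1), of "T \<union> S"] \<pi>(2) S
      by (fastforce simp: m_def)
  qed
  also have "\<dots> = (\<Sum>j\<le>m. real (m choose j) * (fact (m - j) * t ^ j))"
    using fin m sum_Pow_card[of "\<pi> - T" "\<lambda>j. fact (m - j) * t ^ j"] by simp
  also have "\<dots> = fact m * (\<Sum>j\<le>m. t ^ j / fact j)"
    unfolding sum_distrib_left
    by (intro sum.cong refl) (auto simp: binomial_fact)
  also have "\<dots> \<le> fact m * exp t"
  proof (rule mult_left_mono)
    have "summable (\<lambda>j. t ^ j / fact j)" "exp t = (\<Sum>j. t ^ j / fact j)"
      using exp_converges[of t] by (auto simp: sums_iff field_simps)
    then show "(\<Sum>j\<le>m. t ^ j / fact j) \<le> exp t"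
      using t sum_le_suminf[of "\<lambda>j. t ^ j / fact j" "{..m}"] by auto
  qed simp
  finally show ?thesis by (simp add: m_def k_def)
qed

section \<open>Newton series\<close>

definition fwd_diff :: "(nat \<Rightarrow> real) \<Rightarrow> nat \<Rightarrow> real" where
  "fwd_diff f m = f (Suc m) - f m"

definition newton_coeff :: "(nat \<Rightarrow> real) \<Rightarrow> nat \<Rightarrow> real" where
  "newton_coeff f k = (fwd_diff ^^ k) f 0"

text \<open>Induction on \<open>N\<close>, with the hypothesis applied both to \<open>f\<close> and
  to \<open>fwd_diff f\<close>; hence \<open>f\<close> is arbitrary. The two expansions merge by
  Pascal's rule. Any \<open>K\<close> above \<open>N\<close> serves because the further binomials
  vanish.\<close>

lemma newton_forward:
  "N < K \<Longrightarrow> f N = (\<Sum>k<K. real (N choose k) * newton_coeff f k)"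
proof (induction N arbitrary: f K)
  case 0
  then have "(\<Sum>k<K. real (0 choose k) * newton_coeff f k) = (\<Sum>k\<in>{0}. real (0 choose k) * newton_coeff f k)"
    by (intro sum.mono_neutral_right) auto
  then show ?case by (simp add: newton_coeff_def)
next
  case (Suc N)
  then obtain L where L: "K = Suc L" "N < L" by (cases K) auto
  have shift: "newton_coeff (fwd_diff f) k = newton_coeff f (Suc k)" for k
    by (simp add: newton_coeff_def funpow_swap1)
  have "f (Suc N) = f N + fwd_diff f N" by (simp add: fwd_diff_def)
  also have "f N = newton_coeff f 0 + (\<Sum>k<L. real (N choose Suc k) * newton_coeff f (Suc k))"
    using Suc.IH[of K f] L by (simp add: sum.lessThan_Suc_shift del: sum.lessThan_Suc)
  also have "fwd_diff f N = (\<Sum>k<L. real (N choose k) * newton_coeff f (Suc k))"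
    using Suc.IH[OF L(2), of "fwd_diff f"] by (simp add: shift)
  finally show ?case
    by (simp add: L sum.lessThan_Suc_shift sum.distrib distrib_right del: sum.lessThan_Suc)
qed

lemma abs_newton_coeff_le:
  assumes "\<And>m. \<bar>f m\<bar> \<le> B"
  shows "\<bar>newton_coeff f k\<bar> \<le> B * 2 ^ k"
proof -
  have "\<bar>(fwd_diff ^^ k) f m\<bar> \<le> B * 2 ^ k" for m
  proof (induction k arbitrary: m)
    case (Suc k)
    have "\<bar>(fwd_diff ^^ Suc k) f m\<bar> = \<bar>(fwd_diff ^^ k) f (Suc m) - (fwd_diff ^^ k) f m\<bar>"
      by (simp add: fwd_diff_def)
    also have "\<dots> \<le> B * 2 ^ Suc k" using Suc[of m] Suc[of "Suc m"] by simp
    finally show ?case .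
  qed (simp add: assms)
  then show ?thesis by (simp add: newton_coeff_def)
qed

lemma sum_choose_power:
  fixes c :: real
  assumes "N < K" shows "(\<Sum>k<K. real (N choose k) * c ^ k) = (1 + c) ^ N"
proof -
  have "(\<Sum>k<K. real (N choose k) * c ^ k) = (\<Sum>k\<le>N. real (N choose k) * c ^ k)"
    using assms by (intro sum.mono_neutral_right) auto
  also have "\<dots> = (1 + c) ^ N" using binomial_ring[of c 1 N] by (simp add: add.commute)
  finally show ?thesis .
qed

text \<open>In the terms with index k at least \<open>K\<close>, the bound 2^k on the coefficients
  is at most 4^k / 2^K. Raising the base from 2 to 4 thus buys the factor 2^-K, and the binomial
  theorem sums the rest to 5^N.\<close>

lemma newton_truncation:
  assumes B: "\<And>m. \<bar>f m\<bar> \<le> B"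
  shows "\<bar>f N - (\<Sum>k<K. real (N choose k) * newton_coeff f k)\<bar> \<le> B / 2 ^ K * 5 ^ N"
proof -
  \<comment> \<open>Beyond both \<open>K\<close> and \<open>N\<close>, so the expansion up to
    \<open>L\<close> is exact and contains the truncated one.\<close>
  define L where "L = K + Suc N"
  have B0: "0 \<le> B" using B[of 0] by simp
  have split: "{..<L} = {..<K} \<union> {K..<L}" by (auto simp: L_def)
  have "f N - (\<Sum>k<K. real (N choose k) * newton_coeff f k) =
      (\<Sum>k\<in>{K..<L}. real (N choose k) * newton_coeff f k)"
    using newton_forward[of N L f]
    by (simp add: L_def split[unfolded L_def] sum.union_disjoint ivl_disj_int del: add_Suc_right)
  also have "\<bar>\<dots>\<bar> \<le> (\<Sum>k\<in>{K..<L}. B / 2 ^ K * (real (N choose k) * 4 ^ k))"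
  proof (rule order_trans[OF sum_abs], rule sum_mono)
    fix k assume "k \<in> {K..<L}"
    then have "(2::real) ^ k * 2 ^ K \<le> 2 ^ k * 2 ^ k" by (intro mult_left_mono power_increasing) auto
    also have "\<dots> = 4 ^ k" by (simp flip: power_mult_distrib)
    finally have "(2::real) ^ k \<le> 4 ^ k / 2 ^ K" by (simp add: field_simps)
    then have "B * 2 ^ k \<le> B * (4 ^ k / 2 ^ K)" using B0 by (rule mult_left_mono)
    then have "\<bar>newton_coeff f k\<bar> \<le> B * (4 ^ k / 2 ^ K)"
      using abs_newton_coeff_le[of f B k, OF B] by linarith
    then have "real (N choose k) * \<bar>newton_coeff f k\<bar> \<le> real (N choose k) * (B * (4 ^ k / 2 ^ K))"
      by (intro mult_left_mono) auto
    then show "\<bar>real (N choose k) * newton_coeff f k\<bar> \<le> B / 2 ^ K * (real (N choose k) * 4 ^ k)"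
      by (simp add: abs_mult ac_simps)
  qed
  also have "\<dots> \<le> (\<Sum>k<L. B / 2 ^ K * (real (N choose k) * 4 ^ k))"
    using B0 by (intro sum_mono2) (auto simp: L_def)
  also have "\<dots> = B / 2 ^ K * 5 ^ N"
    unfolding sum_distrib_left[symmetric] by (subst sum_choose_power) (auto simp: L_def)
  finally show ?thesis .
qed

text \<open>The k-th binomial moment of the Poisson law is r^k / k!, so this is the Newton expansion
  integrated term by term. The exchange is a Cauchy product: multiplying the series by that of exp r
  gives the k-th term f(k) r^k / k!.\<close>

lemma newton_poisson_sums:
  fixes f :: "nat \<Rightarrow> real"
  assumes r: "0 < r" and B: "\<And>m. \<bar>f m\<bar> \<le> B"
  shows "(\<lambda>k. newton_coeff f k * (r ^ k / fact k)) sums measure_pmf.expectation (poisson_pmf r) f"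
proof -
  define u where "u k = newton_coeff f k * (r ^ k / fact k)" for k
  define v where "v k = r ^ k / fact k" for k
  have v: "v sums exp r" using exp_converges[of r] by (simp add: v_def[abs_def] field_simps)
  have nv: "summable (\<lambda>k. norm (v k))"
    using v r by (simp add: v_def[abs_def] sums_iff)
  have nu: "summable (\<lambda>k. norm (u k))"
  proof (rule summable_comparison_test)
    have "norm (norm (u k)) \<le> B * ((2 * r) ^ k / fact k)" for k
    proof -
      have "\<bar>newton_coeff f k\<bar> * (r ^ k / fact k) \<le> B * 2 ^ k * (r ^ k / fact k)"
        using r by (intro mult_right_mono abs_newton_coeff_le B) auto
      then show ?thesis using r by (simp add: u_def abs_mult power_mult_distrib)
    qed
    then show "\<exists>N. \<forall>k\<ge>N. norm (norm (u k)) \<le> B * ((2 * r) ^ k / fact k)" by blast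
    show "summable (\<lambda>k. B * ((2 * r) ^ k / fact k))"
      using exp_converges[of "2 * r"] by (intro summable_mult) (simp add: sums_iff field_simps)
  qed
  have conv: "(\<Sum>i\<le>k. u i * v (k - i)) = f k * v k" for k
  proof -
    have "(\<Sum>i\<le>k. u i * v (k - i)) = (\<Sum>i\<le>k. real (k choose i) * newton_coeff f i * v k)"
    proof (rule sum.cong[OF refl])
      fix i assume "i \<in> {..k}"
      then have i: "i \<le> k" by simp
      then have "r ^ k = r ^ i * r ^ (k - i)" by (simp flip: power_add)
      then show "u i * v (k - i) = real (k choose i) * newton_coeff f i * v k"
        using i by (simp add: u_def v_def binomial_fact field_simps)
    qed
    also have "\<dots> = f k * v k"
      using newton_forward[of k "Suc k" f] by (simp add: lessThan_Suc_atMost flip: sum_distrib_right)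
    finally show ?thesis .
  qed
  have "(\<lambda>k. f k * v k) sums ((\<Sum>k. u k) * (\<Sum>k. v k))"
    using Cauchy_product_sums[OF nu nv] unfolding conv .
  then have "(\<lambda>k. exp (- r) * (f k * v k)) sums (exp (- r) * ((\<Sum>k. u k) * exp r))"
    using v by (intro sums_mult) (simp add: sums_iff)
  moreover have "exp (- r) * ((\<Sum>k. u k) * exp r) = (\<Sum>k. u k)" by (simp add: exp_minus)
  moreover have "exp (- r) * (f k * v k) = pmf (poisson_pmf r) k * f k" for k
    using r by (simp add: v_def)
  ultimately have 1: "(\<lambda>k. pmf (poisson_pmf r) k * f k) sums (\<Sum>k. u k)"
    by (simp only:)
  have "integrable (measure_pmf (poisson_pmf r)) f"
    by (rule measure_pmf.integrable_const_bound[where B = B]) (use B in auto)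
  then have "integrable (count_space UNIV) (\<lambda>k. pmf (poisson_pmf r) k *\<^sub>R f k)"
    unfolding measure_pmf_eq_density by (subst (asm) integrable_density) auto
  from sums_integral_count_space_nat[OF this]
  have "(\<lambda>k. pmf (poisson_pmf r) k * f k) sums (\<integral>k. pmf (poisson_pmf r) k *\<^sub>R f k \<partial>count_space UNIV)"
    by simp
  also have "(\<integral>k. pmf (poisson_pmf r) k *\<^sub>R f k \<partial>count_space UNIV) = measure_pmf.expectation (poisson_pmf r) f"
    unfolding measure_pmf_eq_density by (subst integral_density) auto
  finally have "measure_pmf.expectation (poisson_pmf r) f = (\<Sum>k. u k)"
    using 1 sums_unique2 by blast
  moreover have "u sums (\<Sum>k. u k)" using summable_norm_cancel[OF nu] by (rule summable_sums)
  ultimately show ?thesis by (simp add: u_def[abs_def])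
qed

section \<open>Independent edge weights of mean one\<close>

text \<open>Serves the L1 estimates below: a pointwise majorant with known expectation yields
  integrability and the bound at once.\<close>

lemma integral_abs_le:
  fixes f g :: "'a \<Rightarrow> real"
  assumes f: "f \<in> borel_measurable M" and g: "integrable M g" and le: "\<And>x. \<bar>f x\<bar> \<le> g x"
  shows "integrable M f" and "(\<integral>x. \<bar>f x\<bar> \<partial>M) \<le> (\<integral>x. g x \<partial>M)"
proof -
  have "norm (f x) \<le> norm (g x)" for x using le[of x] by simp
  then show *: "integrable M f"
    by (intro Bochner_Integration.integrable_bound[OF g f] AE_I2)
  show "(\<integral>x. \<bar>f x\<bar> \<partial>M) \<le> (\<integral>x. g x \<partial>M)"
    by (rule integral_mono[OF integrable_abs[OF *] g le])
qed

lemma integral_double_sum: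
  fixes f :: "'b \<Rightarrow> 'c \<Rightarrow> 'a \<Rightarrow> real"
  assumes "\<And>i j. i \<in> A \<Longrightarrow> j \<in> B \<Longrightarrow> integrable M (f i j)"
  shows "(\<integral>x. (\<Sum>i\<in>A. \<Sum>j\<in>B. f i j x) \<partial>M) = (\<Sum>i\<in>A. \<Sum>j\<in>B. \<integral>x. f i j x \<partial>M)"
  using assms by (simp add: Bochner_Integration.integral_sum)

text \<open>Takes the place of the Cauchy-Schwarz inequality for a \<open>p\<close> with bounded and
  a \<open>q\<close> with vanishing second moment: \<eta> is fixed first, and n tends to infinity
  afterwards.\<close>

lemma abs_mult_le_weighted:
  fixes p q \<eta> :: real
  assumes "0 < \<eta>"
  shows "\<bar>p * q\<bar> \<le> \<eta> / 2 * p ^ 2 + q ^ 2 / (2 * \<eta>)"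
proof -
  have "0 \<le> (\<eta> * \<bar>p\<bar> - \<bar>q\<bar>) ^ 2 / (2 * \<eta>)" using assms by simp
  also have "\<dots> = \<eta> / 2 * p ^ 2 + q ^ 2 / (2 * \<eta>) - \<bar>p * q\<bar>"
    using assms by (simp add: power2_diff abs_mult field_simps power2_eq_square)
  finally show ?thesis by simp
qed

lemma abs_sum_le:
  fixes f g :: "'b \<Rightarrow> real"
  assumes "\<And>i. \<bar>f i\<bar> \<le> g i"
  shows "\<bar>sum f A\<bar> \<le> sum g A"
  using sum_abs[of f A] sum_mono[of A "\<lambda>i. \<bar>f i\<bar>" g] assms by (meson order_trans)

text \<open>The moment sequence \<open>a\<close> is shared by all edges and, in the application, by
  all \<open>n\<close>; bounds in terms of \<open>a\<close> alone are thus uniform in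
  \<open>n\<close>. The lower bound 2 on \<open>n\<close> keeps the factors of
  \<open>prod_approx\<close> at least 1/2.\<close>

locale iid_edge_weights = prob_space M for M :: "'a measure" +
  fixes n :: nat and Y :: "nat \<times> nat \<Rightarrow> 'a \<Rightarrow> real" and a :: "nat \<Rightarrow> real"
  assumes n: "2 \<le> n"
    and indep: "indep_vars (\<lambda>_. borel) Y (edges n)"
    and nonneg: "0 \<le> Y e x"
    and integrable_power: "e \<in> edges n \<Longrightarrow> integrable M (\<lambda>x. Y e x ^ j)"
    and moment: "e \<in> edges n \<Longrightarrow> expectation (\<lambda>x. Y e x ^ j) = a j"
    and mean_1: "a 1 = 1"
begin

section \<open>Moments of products of independent edge weights\<close>

lemma measurable_Y [measurable]: "e \<in> edges n \<Longrightarrow> Y e \<in> borel_measurable M"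
  using indep by (simp add: indep_vars_def)

lemma edge_00: "(0, 0) \<in> edges n"
  using n by (simp add: edges_def)

lemma a_0: "a 0 = 1"
  using moment[OF edge_00, of 0] by (simp add: prob_space)

lemma a_nonneg: "0 \<le> a j"
  using moment[OF edge_00, of j] nonneg by (metis integral_nonneg_AE AE_I2 zero_le_power)

lemma
  fixes h :: "nat \<times> nat \<Rightarrow> real \<Rightarrow> real"
  assumes [measurable]: "\<And>e. e \<in> edges n \<Longrightarrow> h e \<in> borel_measurable borel"
    and int: "\<And>e. e \<in> edges n \<Longrightarrow> integrable M (\<lambda>x. h e (Y e x))"
  shows expectation_prod:
      "expectation (\<lambda>x. \<Prod>e\<in>edges n. h e (Y e x)) = (\<Prod>e\<in>edges n. expectation (\<lambda>x. h e (Y e x)))"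
    and integrable_prod: "integrable M (\<lambda>x. \<Prod>e\<in>edges n. h e (Y e x))"
proof -
  have "indep_vars (\<lambda>_. borel) (\<lambda>e x. h e (Y e x)) (edges n)"
    by (rule indep_vars_compose2[OF indep]) measurable
  from indep_vars_lebesgue_integral[OF finite_edges this int]
    indep_vars_integrable[OF finite_edges this int]
  show "expectation (\<lambda>x. \<Prod>e\<in>edges n. h e (Y e x)) = (\<Prod>e\<in>edges n. expectation (\<lambda>x. h e (Y e x)))"
    and "integrable M (\<lambda>x. \<Prod>e\<in>edges n. h e (Y e x))"
    by auto
qed

lemma one_le_a2: "1 \<le> a 2"
proof -
  note [simp] = integrable_power[OF edge_00, of 2] integrable_power[OF edge_00, of 1, simplified]
  have "0 \<le> expectation (\<lambda>x. (Y (0, 0) x - 1) ^ 2)" by simp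
  also have "\<dots> = expectation (\<lambda>x. Y (0, 0) x ^ 2 - 2 * Y (0, 0) x + 1)"
    by (intro Bochner_Integration.integral_cong) (auto simp: power2_eq_square algebra_simps)
  also have "\<dots> = a 2 - 1"
    using moment[OF edge_00, of 1] moment[OF edge_00, of 2] mean_1 by (simp add: prob_space)
  finally show ?thesis by simp
qed

lemma a2_sq_le_a4: "a 2 ^ 2 \<le> a 4"
proof -
  note [simp] = integrable_power[OF edge_00, of 2] integrable_power[OF edge_00, of 4]
  have "0 \<le> expectation (\<lambda>x. (Y (0, 0) x ^ 2 - a 2) ^ 2)" by simp
  also have "\<dots> = expectation (\<lambda>x. Y (0, 0) x ^ 4 - 2 * a 2 * Y (0, 0) x ^ 2 + a 2 ^ 2)"
    by (intro Bochner_Integration.integral_cong)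
      (auto simp: power2_eq_square algebra_simps power4_eq_xxxx)
  also have "\<dots> = a 4 - a 2 ^ 2"
    using moment[OF edge_00, of 4] moment[OF edge_00, of 2]
    by (simp add: prob_space) (simp add: power2_eq_square)
  finally show ?thesis by simp
qed

definition var :: real where "var = a 2 - 1"

lemma var_nonneg: "0 \<le> var" and a2_eq: "a 2 = 1 + var"
  using one_le_a2 by (auto simp: var_def)

definition weight :: "(nat \<times> nat) set \<Rightarrow> 'a \<Rightarrow> real" where
  "weight S x = (\<Prod>e\<in>S. Y e x)"

text \<open>\<open>ext_avg T\<close> is the \<open>Z\<^sub>T\<close> above, a normalised permanent of the minor of \<open>Y\<close> that avoids \<open>T\<close>;
  in particular \<open>ext_avg {}\<close> is \<open>Z\<close>, while \<open>prod_approx\<close> is \<open>G\<close>.\<close>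

definition ext_avg :: "(nat \<times> nat) set \<Rightarrow> 'a \<Rightarrow> real" where
  "ext_avg T x = (\<Sum>\<pi> | \<pi> \<in> perfect_matchings n \<and> T \<subseteq> \<pi>. weight (\<pi> - T) x) / fact (n - card T)"

definition prod_approx :: "'a \<Rightarrow> real" where
  "prod_approx x = (\<Prod>e\<in>edges n. 1 + (Y e x - 1) / n)"

lemma weight_nonneg: "0 \<le> weight S x"
  by (simp add: weight_def nonneg prod_nonneg)

text \<open>As monomials in all edge weights, these products are multiplied by adding exponents, and
  the expectation then factorises edge by edge through \<open>expectation_monomial\<close>.\<close>

lemma weight_conv:
  assumes "S \<subseteq> edges n" shows "weight S x = (\<Prod>e\<in>edges n. Y e x ^ of_bool (e \<in> S))"
proof -
  have "edges n \<inter> S = S" using assms by auto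
  then have "weight S x = (\<Prod>e\<in>edges n. if e \<in> S then Y e x else 1)"
    by (simp add: weight_def prod.If_cases finite_edges)
  also have "\<dots> = (\<Prod>e\<in>edges n. Y e x ^ of_bool (e \<in> S))"
    by (intro prod.cong) auto
  finally show ?thesis .
qed

lemma measurable_weight [measurable]: "S \<subseteq> edges n \<Longrightarrow> weight S \<in> borel_measurable M"
  unfolding weight_def by measurable (auto dest: subsetD)

lemma perfect_matching_edges: "\<pi> \<in> perfect_matchings n \<Longrightarrow> \<pi> \<subseteq> edges n"
  by (auto simp: perfect_matchings_def)

lemma measurable_ext_avg [measurable]: "ext_avg T \<in> borel_measurable M"
  unfolding ext_avg_def
  by (intro borel_measurable_divide borel_measurable_sum measurable_weight)
    (auto dest: perfect_matching_edges)

lemma measurable_prod_approx [measurable]: "prod_approx \<in> borel_measurable M"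
  unfolding prod_approx_def by measurable

lemma
  shows expectation_monomial: "expectation (\<lambda>x. \<Prod>e\<in>edges n. Y e x ^ c e) = (\<Prod>e\<in>edges n. a (c e))"
    and integrable_monomial: "integrable M (\<lambda>x. \<Prod>e\<in>edges n. Y e x ^ c e)"
  using expectation_prod[of "\<lambda>e y. y ^ c e"] integrable_prod[of "\<lambda>e y. y ^ c e"]
  by (auto simp: integrable_power moment)

lemma prod_edges_of_bool:
  fixes c :: real
  assumes "S \<subseteq> edges n" shows "(\<Prod>e\<in>edges n. if e \<in> S then c else 1) = c ^ card S"
proof -
  have "edges n \<inter> S = S" using assms by auto
  then show ?thesis by (simp add: prod.If_cases finite_edges)
qed

text \<open>The exponent \<open>c e\<close> is \<open>j\<close> on \<open>T\<close>, 2 on the common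
  edges outside \<open>T\<close>, and 0 or 1 elsewhere. As \<open>a 0\<close> and \<open>a 1\<close>
  are both 1, only the first two kinds of edge contribute.\<close>

lemma
  assumes "T \<subseteq> edges n" "\<pi> \<subseteq> edges n" "\<pi>' \<subseteq> edges n"
  shows expectation_weights:
      "expectation (\<lambda>x. weight T x ^ j * (weight (\<pi> - T) x * weight (\<pi>' - T) x)) =
        a j ^ card T * a 2 ^ card (\<pi> \<inter> \<pi>' - T)" (is ?eq)
    and integrable_weights:
      "integrable M (\<lambda>x. weight T x ^ j * (weight (\<pi> - T) x * weight (\<pi>' - T) x))" (is ?int)
proof -
  define c where "c e = j * of_bool (e \<in> T) + of_bool (e \<in> \<pi> - T) + of_bool (e \<in> \<pi>' - T)" for e
  have *: "weight T x ^ j * (weight (\<pi> - T) x * weight (\<pi>' - T) x) = (\<Prod>e\<in>edges n. Y e x ^ c e)" for x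
  proof -
    have "\<pi> - T \<subseteq> edges n" "\<pi>' - T \<subseteq> edges n" using assms by auto
    then show ?thesis using assms
      by (simp add: weight_conv c_def power_add power_mult prod.distrib prod_power_distrib
          flip: power_mult_distrib) (simp add: mult.commute flip: power_mult)
  qed
  show ?int unfolding * by (rule integrable_monomial)
  have "(\<Prod>e\<in>edges n. a (c e)) =
      (\<Prod>e\<in>edges n. (if e \<in> T then a j else 1) * (if e \<in> \<pi> \<inter> \<pi>' - T then a 2 else 1))"
    by (intro prod.cong refl) (auto simp: c_def a_0 mean_1[unfolded One_nat_def] numeral_2_eq_2)
  also have "\<dots> = a j ^ card T * a 2 ^ card (\<pi> \<inter> \<pi>' - T)"
    using assms by (subst prod.distrib, subst (1 2) prod_edges_of_bool) auto
  finally show ?eq unfolding * expectation_monomial .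
qed


section \<open>Second moments and the approximation of \<open>ext_avg\<close> by
  \<open>prod_approx\<close>\<close>

lemma perfect_matching_edges_Diff: "\<pi> \<in> perfect_matchings n \<Longrightarrow> \<pi> - T \<subseteq> edges n"
  by (auto simp: perfect_matchings_def)

lemma card_partial_matching:
  assumes "T \<in> partial_matchings n k"
  shows "T \<subseteq> edges n" "card T = k" "k \<le> n" "finite T"
proof -
  obtain \<pi> where \<pi>: "\<pi> \<in> perfect_matchings n" "T \<subseteq> \<pi>" "card T = k"
    using assms by (auto simp: partial_matchings_def)
  show "T \<subseteq> edges n" "card T = k" using \<pi> by (auto simp: perfect_matchings_def)
  show "k \<le> n" using \<pi> card_perfect_matching[OF \<pi>(1)] card_mono by metis
  show "finite T" using \<pi> card_perfect_matching[OF \<pi>(1)] finite_subset by metis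
qed

lemma empty_partial_matching: "{} \<in> partial_matchings n 0"
  using perfect_matchings_nonempty by (auto simp: partial_matchings_def)

text \<open>The square is a double sum over pairs of extensions of \<open>T\<close>. Each pair has
  expectation \<open>a j ^ k\<close> times a power of 1 + var whose exponent counts the common edges
  outside \<open>T\<close>, so the counting bound with \<open>t = var\<close> applies.\<close>

lemma
  assumes T: "T \<in> partial_matchings n k"
  shows expectation_weight_ext_avg_sq_le:
      "expectation (\<lambda>x. weight T x ^ j * ext_avg T x ^ 2) \<le> a j ^ k * exp var" (is ?le)
    and integrable_weight_ext_avg_sq:
      "integrable M (\<lambda>x. weight T x ^ j * ext_avg T x ^ 2)" (is ?int)
proof -
  let ?P = "{\<pi> \<in> perfect_matchings n. T \<subseteq> \<pi>}"
  let ?F = "fact (n - k) :: real"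
  note T' = card_partial_matching[OF T]
  have P: "\<pi> \<subseteq> edges n" if "\<pi> \<in> ?P" for \<pi> using that perfect_matching_edges by auto
  have cP: "real (card ?P) = ?F"
    using T card_perfect_matchings_superset by (auto simp: partial_matchings_def)
  have *: "weight T x ^ j * ext_avg T x ^ 2 =
      (\<Sum>\<pi>\<in>?P. \<Sum>\<pi>'\<in>?P. weight T x ^ j * (weight (\<pi> - T) x * weight (\<pi>' - T) x)) / ?F ^ 2" for x
  proof -
    have "(\<Sum>\<pi>\<in>?P. weight (\<pi> - T) x) ^ 2 =
        (\<Sum>\<pi>\<in>?P. \<Sum>\<pi>'\<in>?P. weight (\<pi> - T) x * weight (\<pi>' - T) x)"
      unfolding power2_eq_square sum_product ..
    then show ?thesis by (simp add: ext_avg_def T'(2) power_divide sum_distrib_left)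
  qed
  show ?int unfolding *
    by (intro integrable_divide Bochner_Integration.integrable_sum integrable_weights P T'(1))
  have "expectation (\<lambda>x. weight T x ^ j * ext_avg T x ^ 2) =
      (\<Sum>\<pi>\<in>?P. \<Sum>\<pi>'\<in>?P. expectation (\<lambda>x. weight T x ^ j * (weight (\<pi> - T) x * weight (\<pi>' - T) x))) / ?F ^ 2"
    unfolding * by (subst integral_divide_zero, subst integral_double_sum)
      (use P T'(1) in \<open>auto intro: integrable_weights\<close>)
  also have "\<dots> = (\<Sum>\<pi>\<in>?P. \<Sum>\<pi>'\<in>?P. a j ^ k * (1 + var) ^ card (\<pi> \<inter> \<pi>' - T)) / ?F ^ 2"
    using P T'(1) by (simp add: expectation_weights T'(2) a2_eq)
  also have "\<dots> = a j ^ k * (\<Sum>\<pi>\<in>?P. \<Sum>\<pi>'\<in>?P. (1 + var) ^ card (\<pi> \<inter> \<pi>' - T)) / ?F ^ 2"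
    by (simp add: sum_distrib_left)
  also have "\<dots> \<le> a j ^ k * (\<Sum>\<pi>\<in>?P. ?F * exp var) / ?F ^ 2"
    using sum_perfect_matchings_power_overlap_le[where t = var and T = T and n = n] var_nonneg T'(2)
    by (intro divide_right_mono mult_left_mono sum_mono) (auto simp: a_nonneg)
  also have "\<dots> = a j ^ k * exp var"
    by (simp only: sum_constant cP) (simp add: power2_eq_square)
  finally show ?le .
qed

text \<open>The contribution of an edge has mean E Y(1 + (Y - 1)/n) = 1 + var/n on \<pi> - T and
  mean 1 off it, so every extension \<pi> of \<open>T\<close> yields the same power.\<close>

lemma
  assumes T: "T \<in> partial_matchings n k"
  shows expectation_ext_avg_prod_approx:
      "expectation (\<lambda>x. ext_avg T x * prod_approx x) = (1 + var / n) ^ (n - k)" (is ?eq)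
    and integrable_ext_avg_prod_approx:
      "integrable M (\<lambda>x. ext_avg T x * prod_approx x)" (is ?int)
proof -
  let ?P = "{\<pi> \<in> perfect_matchings n. T \<subseteq> \<pi>}"
  let ?F = "fact (n - k) :: real"
  note T' = card_partial_matching[OF T]
  have cP: "real (card ?P) = ?F"
    using T card_perfect_matchings_superset by (auto simp: partial_matchings_def)
  define h where "h S e y = y ^ of_bool (e \<in> S) * (1 + (y - 1) / n)" for S :: "(nat \<times> nat) set" and e and y :: real
  \<comment> \<open>A combination of two powers of \<open>y\<close>, so that the moment assumptions
    give integrability and expectation.\<close>
  have h_split: "h S e y = (1 - 1 / n) * y ^ of_bool (e \<in> S) + (1 / n) * y ^ Suc (of_bool (e \<in> S))" for S e y
    using n by (simp add: h_def field_simps)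
  have [measurable]: "h S e \<in> borel_measurable borel" for S e unfolding h_def by measurable
  have hint: "integrable M (\<lambda>x. h S e (Y e x))" if "e \<in> edges n" for S e
    unfolding h_split by (intro Bochner_Integration.integrable_add integrable_mult_right integrable_power that)
  have hexp: "expectation (\<lambda>x. h S e (Y e x)) = (if e \<in> S then 1 + var / n else 1)" if "e \<in> edges n" for S e
  proof -
    have "expectation (\<lambda>x. h S e (Y e x)) =
        (1 - 1 / n) * a (of_bool (e \<in> S)) + (1 / n) * a (Suc (of_bool (e \<in> S)))"
      unfolding h_split
      by (subst Bochner_Integration.integral_add)
        (simp_all only: integral_mult_right_zero moment[OF that] integrable_mult_right integrable_power[OF that])
    also have "\<dots> = (if e \<in> S then 1 + var / n else 1)"
      using n a_0 mean_1 by (simp add: field_simps var_def numeral_2_eq_2)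
    finally show ?thesis .
  qed
  have wh: "weight S x * prod_approx x = (\<Prod>e\<in>edges n. h S e (Y e x))" if "S \<subseteq> edges n" for S x
    using that by (simp add: weight_conv prod_approx_def h_def prod.distrib)
  have wint: "integrable M (\<lambda>x. weight S x * prod_approx x)" if "S \<subseteq> edges n" for S
    unfolding wh[OF that] by (intro integrable_prod hint) auto
  have wexp: "expectation (\<lambda>x. weight S x * prod_approx x) = (1 + var / n) ^ card S" if "S \<subseteq> edges n" for S
    unfolding wh[OF that]
    by (subst expectation_prod) (auto simp: hint hexp prod_edges_of_bool[OF that] cong: prod.cong)
  have *: "ext_avg T x * prod_approx x = (\<Sum>\<pi>\<in>?P. weight (\<pi> - T) x * prod_approx x) / ?F" for x
    by (simp add: ext_avg_def T'(2) sum_distrib_right)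
  show ?int unfolding *
    by (intro integrable_divide Bochner_Integration.integrable_sum wint) (auto dest: perfect_matching_edges)
  have "expectation (\<lambda>x. ext_avg T x * prod_approx x) =
      (\<Sum>\<pi>\<in>?P. expectation (\<lambda>x. weight (\<pi> - T) x * prod_approx x)) / ?F"
    unfolding * by (simp add: Bochner_Integration.integral_sum wint perfect_matching_edges_Diff)
  also have "\<dots> = (\<Sum>\<pi>\<in>?P. (1 + var / n) ^ (n - k)) / ?F"
    using T'(2,4) card_perfect_matching
    by (intro arg_cong2[where f = "(/)"] sum.cong refl)
      (auto simp: wexp perfect_matching_edges_Diff card_Diff_subset)
  also have "\<dots> = (1 + var / n) ^ (n - k)" by (simp only: sum_constant cP) simp
  finally show ?eq .
qed

lemma expectation_Y_minus_1:
  assumes e: "e \<in> edges n"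
  shows "integrable M (\<lambda>x. (Y e x - 1) ^ j)" and "expectation (\<lambda>x. Y e x - 1) = 0"
    and "expectation (\<lambda>x. (Y e x - 1) ^ 2) = var" and "expectation (\<lambda>x. (Y e x - 1) ^ 4) \<le> a 4 + 1"
proof -
  note [simp] = integrable_power[OF e] integrable_power[OF e, of 1, simplified]
  have *: "(Y e x - 1) ^ j = (\<Sum>i\<le>j. of_nat (j choose i) * Y e x ^ i * (- 1) ^ (j - i))" for x j
    using binomial_ring[of "Y e x" "- 1" j] by simp
  have int: "integrable M (\<lambda>x. (Y e x - 1) ^ j)" for j unfolding * by simp
  then show "integrable M (\<lambda>x. (Y e x - 1) ^ j)" .
  show "expectation (\<lambda>x. Y e x - 1) = 0"
    using moment[OF e, of 1] mean_1 by (simp add: prob_space)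
  have "expectation (\<lambda>x. (Y e x - 1) ^ 2) = expectation (\<lambda>x. Y e x ^ 2 - 2 * Y e x + 1)"
    by (intro Bochner_Integration.integral_cong) (auto simp: power2_eq_square algebra_simps)
  also have "\<dots> = var"
    using moment[OF e, of 1] moment[OF e, of 2] mean_1 by (simp add: prob_space var_def)
  finally show "expectation (\<lambda>x. (Y e x - 1) ^ 2) = var" .
  \<comment> \<open>For nonnegative \<open>y\<close> the distance to 1 is at most the larger of 1
    and \<open>y\<close>.\<close>
  have "(y - 1) ^ 4 \<le> y ^ 4 + 1" if "0 \<le> y" for y :: real
  proof (cases "y \<le> 1")
    case True
    then have "(y - 1) ^ 4 = (1 - y) ^ 4" by (simp add: power2_commute power4_eq_xxxx algebra_simps)
    also have "\<dots> \<le> 1" using True that by (intro power_le_one) auto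
    also have "\<dots> \<le> y ^ 4 + 1" by simp
    finally show ?thesis .
  next
    case False
    then have "(y - 1) ^ 4 \<le> y ^ 4" by (intro power_mono) auto
    then show ?thesis by simp
  qed
  then have "expectation (\<lambda>x. (Y e x - 1) ^ 4) \<le> expectation (\<lambda>x. Y e x ^ 4 + 1)"
    using int[of 4] nonneg by (intro integral_mono) auto
  then show "expectation (\<lambda>x. (Y e x - 1) ^ 4) \<le> a 4 + 1"
    using moment[OF e, of 4] by (simp add: prob_space)
qed

text \<open>There are n^2 edges, and 1 + c/n^2 is at most exp (c/n^2). Factors with mean 1 +
  O(1/n^2) therefore have a product bounded uniformly in n.\<close>

lemma prod_edges_le_exp:
  fixes b :: "nat \<times> nat \<Rightarrow> real"
  assumes "\<And>e. e \<in> edges n \<Longrightarrow> 0 \<le> b e" "\<And>e. e \<in> edges n \<Longrightarrow> b e \<le> 1 + c / n ^ 2" 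
  shows "(\<Prod>e\<in>edges n. b e) \<le> exp c"
proof -
  have "(\<Prod>e\<in>edges n. b e) \<le> (\<Prod>e\<in>edges n. exp (c / n ^ 2))"
  proof (rule prod_mono)
    fix e assume "e \<in> edges n"
    then show "0 \<le> b e \<and> b e \<le> exp (c / n ^ 2)"
      using assms exp_ge_add_one_self[of "c / n ^ 2"] by (smt (verit))
  qed
  also have "\<dots> = exp (real (n ^ 2) * (c / n ^ 2))"
    by (simp add: edges_def power2_eq_square exp_of_nat_mult[symmetric])
  also have "\<dots> = exp c" using n by simp
  finally show ?thesis .
qed

text \<open>Collects the coefficients of the quartic majorant of (1 + z)^4 used below, with
  \<open>var\<close> for the second moment of Y - 1 and \<open>a 4 + 1\<close> as a bound for the
  fourth.\<close>

definition pow4_rate :: real where "pow4_rate = 8 * var + 3 * (a 4 + 1)"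

text \<open>The term linear in (Y - 1)/n has mean zero, so the square and the fourth power of each
  factor have mean at most 1 + O(1/n^2), as \<open>prod_edges_le_exp\<close> requires.\<close>

lemma
  shows expectation_prod_approx_sq_le: "expectation (\<lambda>x. prod_approx x ^ 2) \<le> exp var" (is ?A)
    and integrable_prod_approx_sq: "integrable M (\<lambda>x. prod_approx x ^ 2)" (is ?B)
    and expectation_prod_approx_pow4_le: "expectation (\<lambda>x. prod_approx x ^ 4) \<le> exp pow4_rate" (is ?C)
    and integrable_prod_approx_pow4: "integrable M (\<lambda>x. prod_approx x ^ 4)" (is ?D)
proof -
  have pw: "prod_approx x ^ j = (\<Prod>e\<in>edges n. (\<lambda>y. (1 + (y - 1) / n) ^ j) (Y e x))" for j x
    by (simp add: prod_approx_def prod_power_distrib)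
  have int: "integrable M (\<lambda>x. (1 + (Y e x - 1) / n) ^ j)" if "e \<in> edges n" for e j
    using expectation_Y_minus_1(1)[OF that]
    by (simp add: binomial_ring[of 1] power_divide)
  show ?B ?D unfolding pw by (intro integrable_prod int; simp)+
  have nn: "0 \<le> 1 + (Y e x - 1) / n" for e x
    using nonneg[of e x] n by (simp add: field_simps)
  have le_exp: "expectation (\<lambda>x. prod_approx x ^ j) \<le> exp c"
    if "\<And>e. e \<in> edges n \<Longrightarrow> expectation (\<lambda>x. (1 + (Y e x - 1) / n) ^ j) \<le> 1 + c / n ^ 2" for j c
  proof -
    have "expectation (\<lambda>x. prod_approx x ^ j) =
        (\<Prod>e\<in>edges n. expectation (\<lambda>x. (1 + (Y e x - 1) / n) ^ j))"
      unfolding pw by (rule expectation_prod) (auto simp: int)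
    also have "\<dots> \<le> exp c"
      by (rule prod_edges_le_exp) (use that nn in \<open>auto intro!: Bochner_Integration.integral_nonneg\<close>)
    finally show ?thesis .
  qed
  have sq: "expectation (\<lambda>x. (1 + (Y e x - 1) / n) ^ 2) = 1 + var / n ^ 2" if e: "e \<in> edges n" for e
  proof -
    have "expectation (\<lambda>x. (1 + (Y e x - 1) / n) ^ 2) =
      expectation (\<lambda>x. 1 + 2 / n * (Y e x - 1) + (Y e x - 1) ^ 2 / n ^ 2)"
      by (intro Bochner_Integration.integral_cong) (use n in \<open>auto simp: power2_eq_square field_simps\<close>)
    also have "\<dots> = 1 + var / n ^ 2"
    proof -
      have "expectation (\<lambda>x. 1 + 2 / n * z x + z x ^ 2 / n ^ 2) =
          1 + 2 / n * expectation z + expectation (\<lambda>x. z x ^ 2) / n ^ 2"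
        if "integrable M z" "integrable M (\<lambda>x. z x ^ 2)" for z
        using that by (simp add: prob_space)
      from this[of "\<lambda>x. Y e x - 1"] show ?thesis
        using expectation_Y_minus_1(1)[OF e, of 1] expectation_Y_minus_1(1)[OF e, of 2]
        expectation_Y_minus_1(2,3)[OF e] by simp
    qed
    finally show ?thesis .
  qed
  then show ?A by (intro le_exp) simp
  have p4: "expectation (\<lambda>x. (1 + (Y e x - 1) / n) ^ 4) \<le> 1 + pow4_rate / n ^ 2" if e: "e \<in> edges n" for e
  proof -
    \<comment> \<open>The cubic term is absorbed into the quadratic and quartic ones, so no third
      moment enters; the difference of the two sides is twice a square.\<close>
    have le: "(1 + z) ^ 4 \<le> 1 + 4 * z + 8 * z ^ 2 + 3 * z ^ 4" for z :: real
    proof -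
      have "1 + 4 * z + 8 * z ^ 2 + 3 * z ^ 4 - (1 + z) ^ 4 = 2 * (z * (1 - z)) ^ 2"
        by (simp add: power2_eq_square power4_eq_xxxx algebra_simps)
      moreover have "0 \<le> 2 * (z * (1 - z)) ^ 2" by simp
      ultimately show ?thesis by linarith
    qed
    have "expectation (\<lambda>x. (1 + (Y e x - 1) / n) ^ 4) \<le>
        expectation (\<lambda>x. 1 + 4 * ((Y e x - 1) / n) + 8 * ((Y e x - 1) / n) ^ 2 + 3 * ((Y e x - 1) / n) ^ 4)"
    proof (rule integral_mono[OF int[OF e] _ le])
      have "integrable M (\<lambda>x. 1 + 4 * (z x / n) + 8 * (z x / n) ^ 2 + 3 * (z x / n) ^ 4)"
        if "integrable M z" "integrable M (\<lambda>x. z x ^ 2)" "integrable M (\<lambda>x. z x ^ 4)" for z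
        using that by (simp add: power_divide)
      from this[of "\<lambda>x. Y e x - 1"]
      show "integrable M (\<lambda>x. 1 + 4 * ((Y e x - 1) / n) + 8 * ((Y e x - 1) / n) ^ 2
          + 3 * ((Y e x - 1) / n) ^ 4)"
        using expectation_Y_minus_1(1)[OF e, of 1] expectation_Y_minus_1(1)[OF e, of 2]
          expectation_Y_minus_1(1)[OF e, of 4] by simp
    qed
    also have "\<dots> = 1 + 8 * var / n ^ 2 + 3 * expectation (\<lambda>x. (Y e x - 1) ^ 4) / n ^ 4"
    proof -
      have "expectation (\<lambda>x. 1 + 4 * (z x / n) + 8 * (z x / n) ^ 2 + 3 * (z x / n) ^ 4) =
          1 + 4 * (expectation z / n) + 8 * (expectation (\<lambda>x. z x ^ 2) / n ^ 2) +
          3 * (expectation (\<lambda>x. z x ^ 4) / n ^ 4)"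
        if "integrable M z" "integrable M (\<lambda>x. z x ^ 2)" "integrable M (\<lambda>x. z x ^ 4)" for z
        using that by (simp add: prob_space power_divide)
      from this[of "\<lambda>x. Y e x - 1"] show ?thesis
        using expectation_Y_minus_1(1)[OF e, of 1] expectation_Y_minus_1(1)[OF e, of 2]
          expectation_Y_minus_1(1)[OF e, of 4] expectation_Y_minus_1(2,3)[OF e] by simp
    qed
    also have "\<dots> \<le> 1 + 8 * var / n ^ 2 + 3 * (a 4 + 1) / n ^ 2"
    proof -
      have "real n ^ 2 \<le> real n ^ 4" using n by (intro power_increasing) auto
      then have "3 * expectation (\<lambda>x. (Y e x - 1) ^ 4) / n ^ 4 \<le> 3 * (a 4 + 1) / n ^ 2"
        using expectation_Y_minus_1(4)[OF e] a_nonneg[of 4] n by (intro frac_le) auto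
      then show ?thesis by simp
    qed
    also have "\<dots> = 1 + pow4_rate / n ^ 2" by (simp add: pow4_rate_def add_divide_distrib)
    finally show ?thesis .
  qed
  then show ?C by (rule le_exp)
qed

text \<open>Bounds the second moment of \<open>ext_avg T - prod_approx\<close>: the two squares
  contribute at most \<open>exp var\<close> each, and the cross term is known exactly. It tends to 0
  because the power tends to \<open>exp var\<close>.\<close>

definition l2_error :: "nat \<Rightarrow> real" where "l2_error k = 2 * exp var - 2 * (1 + var / n) ^ (n - k)"

lemma
  assumes T: "T \<in> partial_matchings n k"
  shows expectation_ext_avg_minus_prod_approx_sq_le:
      "expectation (\<lambda>x. (ext_avg T x - prod_approx x) ^ 2) \<le> l2_error k" (is ?A)
    and integrable_ext_avg_minus_prod_approx_sq:
      "integrable M (\<lambda>x. (ext_avg T x - prod_approx x) ^ 2)" (is ?B)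
proof -
  note [simp] = integrable_weight_ext_avg_sq[OF T, of 0, simplified]
    integrable_prod_approx_sq integrable_ext_avg_prod_approx[OF T]
  have *: "(ext_avg T x - prod_approx x) ^ 2 =
      ext_avg T x ^ 2 - 2 * (ext_avg T x * prod_approx x) + prod_approx x ^ 2" for x
    by (simp add: power2_eq_square algebra_simps)
  show ?B unfolding * by simp
  show ?A unfolding * l2_error_def
    using expectation_weight_ext_avg_sq_le[OF T, of 0] expectation_prod_approx_sq_le
    by (simp add: expectation_ext_avg_prod_approx[OF T] a_0)
qed

section \<open>L1 estimates for the factorial moments of the overlap\<close>

lemma
  assumes T: "T \<in> partial_matchings n k"
  shows expectation_weight_power: "expectation (\<lambda>x. weight T x ^ j) = a j ^ k"
    and integrable_weight_power: "integrable M (\<lambda>x. weight T x ^ j)"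
  using expectation_weights[of T T T j] integrable_weights[of T T T j] card_partial_matching[OF T]
  by (auto simp: weight_def)

text \<open>The coefficient of \<eta> in the next estimate. It depends on \<open>k\<close> and the
  moments but not on \<open>n\<close>, which allows \<eta> to be chosen before
  \<open>n\<close>.\<close>

definition l1_const :: "nat \<Rightarrow> real" where
  "l1_const k = a 4 ^ k * exp var + a 8 ^ k / 2 + exp pow4_rate / 2"

text \<open>The difference of squares is factored: \<open>ext_avg T - prod_approx\<close> is small
  in L2, and the cofactor has bounded second moment. The majorant \<open>H\<close> results from
  \<open>abs_mult_le_weighted\<close>.\<close>

lemma
  assumes T: "T \<in> partial_matchings n k" and \<eta>: "0 < \<eta>"
  shows integrable_weight_sq_diff:
      "integrable M (\<lambda>x. weight T x ^ 2 * (ext_avg T x ^ 2 - prod_approx x ^ 2))" (is ?int)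
    and expectation_weight_sq_diff_le:
      "expectation (\<lambda>x. \<bar>weight T x ^ 2 * (ext_avg T x ^ 2 - prod_approx x ^ 2)\<bar>)
        \<le> \<eta> * l1_const k + l2_error k / (2 * \<eta>)" (is ?le)
proof -
  define H where "H x = \<eta> * (weight T x ^ 4 * ext_avg T x ^ 2) +
      \<eta> / 2 * (weight T x ^ 8 + prod_approx x ^ 4) +
      (ext_avg T x - prod_approx x) ^ 2 / (2 * \<eta>)" for x
  note T' = card_partial_matching[OF T]
  note [simp] = integrable_weight_ext_avg_sq[OF T] integrable_weight_power[OF T]
    integrable_prod_approx_pow4 integrable_ext_avg_minus_prod_approx_sq[OF T]
  have intH: "integrable M H" unfolding H_def by simp
  have "expectation H = \<eta> * expectation (\<lambda>x. weight T x ^ 4 * ext_avg T x ^ 2) +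
      \<eta> / 2 * (a 8 ^ k + expectation (\<lambda>x. prod_approx x ^ 4)) +
      expectation (\<lambda>x. (ext_avg T x - prod_approx x) ^ 2) / (2 * \<eta>)"
    unfolding H_def by (simp add: expectation_weight_power[OF T])
  also have "\<dots> \<le> \<eta> * (a 4 ^ k * exp var) + \<eta> / 2 * (a 8 ^ k + exp pow4_rate) + l2_error k / (2 * \<eta>)"
    using \<eta> by (intro add_mono mult_left_mono divide_right_mono order_refl
        expectation_weight_ext_avg_sq_le[OF T] expectation_prod_approx_pow4_le
        expectation_ext_avg_minus_prod_approx_sq_le[OF T]) auto
  also have "\<dots> = \<eta> * l1_const k + l2_error k / (2 * \<eta>)" by (simp add: l1_const_def algebra_simps)
  finally have EH: "expectation H \<le> \<eta> * l1_const k + l2_error k / (2 * \<eta>)" .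
  have le: "\<bar>weight T x ^ 2 * (ext_avg T x ^ 2 - prod_approx x ^ 2)\<bar> \<le> H x" for x
  proof -
    have *: "\<bar>w ^ 2 * (u ^ 2 - g ^ 2)\<bar> \<le>
        \<eta> * (w ^ 4 * u ^ 2) + \<eta> / 2 * (w ^ 8 + g ^ 4) + (u - g) ^ 2 / (2 * \<eta>)" for w u g :: real
    proof -
      have "w ^ 2 * (u ^ 2 - g ^ 2) = (w ^ 2 * (u + g)) * (u - g)"
        by (simp add: power2_eq_square algebra_simps)
      then have "\<bar>w ^ 2 * (u ^ 2 - g ^ 2)\<bar> \<le> \<eta> / 2 * (w ^ 2 * (u + g)) ^ 2 + (u - g) ^ 2 / (2 * \<eta>)"
        using abs_mult_le_weighted[OF \<eta>] by metis
      \<comment> \<open>The mixed terms in \<open>w\<close> and \<open>g\<close> are split into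
        \<open>w ^ 8\<close> and \<open>g ^ 4\<close>, so that only separate moments of
        \<open>weight T\<close> and \<open>prod_approx\<close> enter.\<close>
      moreover have "(w ^ 2 * (u + g)) ^ 2 \<le> 2 * (w ^ 4 * u ^ 2) + (w ^ 8 + g ^ 4)"
      proof -
        have "2 * (w ^ 4 * u ^ 2) + (w ^ 8 + g ^ 4) - (w ^ 2 * (u + g)) ^ 2 =
            (w ^ 2 * (u - g)) ^ 2 + (w ^ 4 - g ^ 2) ^ 2"
          by (simp add: power2_eq_square algebra_simps eval_nat_numeral)
        moreover have "0 \<le> (w ^ 2 * (u - g)) ^ 2 + (w ^ 4 - g ^ 2) ^ 2" by simp
        ultimately show ?thesis by linarith
      qed
      then have "\<eta> / 2 * (w ^ 2 * (u + g)) ^ 2 \<le> \<eta> / 2 * (2 * (w ^ 4 * u ^ 2) + (w ^ 8 + g ^ 4))"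
        using \<eta> by (intro mult_left_mono) auto
      ultimately show ?thesis by (simp add: algebra_simps)
    qed
    show ?thesis unfolding H_def by (rule *)
  qed
  have [measurable]: "weight T \<in> borel_measurable M" using T'(1) by measurable
  have meas: "(\<lambda>x. weight T x ^ 2 * (ext_avg T x ^ 2 - prod_approx x ^ 2)) \<in> borel_measurable M"
    by measurable
  show ?int using integral_abs_le(1)[OF meas intH le] .
  show ?le using integral_abs_le(2)[OF meas intH le] EH by simp
qed

text \<open>Common edges contribute \<open>a 4\<close>, edges of exactly one set \<open>a 2\<close>.
  Disjoint sets give the first summand; otherwise a2_sq_le_a4 bounds everything by
  \<open>a 4 ^ k\<close>, and the overlap is at least 1. A bound linear in the overlap can be
  averaged by \<open>sum_card_Int_partial_matchings\<close>.\<close>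

lemma
  assumes T: "T \<in> partial_matchings n k" and T': "T' \<in> partial_matchings n k"
  shows expectation_weight_sq_mult_le:
      "expectation (\<lambda>x. weight T x ^ 2 * weight T' x ^ 2) \<le>
        a 2 ^ (2 * k) + a 4 ^ k * card (T \<inter> T')" (is ?le)
    and integrable_weight_sq_mult:
      "integrable M (\<lambda>x. weight T x ^ 2 * weight T' x ^ 2)" (is ?int)
proof -
  note T1 = card_partial_matching[OF T] and T2 = card_partial_matching[OF T']
  define c :: "nat \<times> nat \<Rightarrow> nat" where "c e = 2 * of_bool (e \<in> T) + 2 * of_bool (e \<in> T')" for e
  have *: "weight T x ^ 2 * weight T' x ^ 2 = (\<Prod>e\<in>edges n. Y e x ^ c e)" for x
    using T1(1) T2(1)
    by (simp add: weight_conv c_def power_add prod.distrib prod_power_distrib power_mult mult.commute[of 2])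
  show ?int unfolding * by (rule integrable_monomial)
  let ?D = "(T - T') \<union> (T' - T)"
  let ?i = "card (T \<inter> T')"
  have i: "?i \<le> k" using card_mono[OF T1(4), of "T \<inter> T'"] T1(2) by simp
  have "card ?D = (k - ?i) + (k - ?i)"
    using T1(2,4) T2(2,4) by (subst card_Un_disjoint) (auto simp: card_Diff_subset_Int Int_commute)
  then have D: "card ?D = 2 * (k - ?i)" by simp
  have "(\<Prod>e\<in>edges n. a (c e)) =
      (\<Prod>e\<in>edges n. (if e \<in> T \<inter> T' then a 4 else 1) * (if e \<in> ?D then a 2 else 1))"
    by (intro prod.cong refl) (auto simp: c_def a_0 eval_nat_numeral)
  also have "\<dots> = a 4 ^ ?i * a 2 ^ card ?D"
    using T1(1) T2(1) by (subst prod.distrib, subst (1 2) prod_edges_of_bool) auto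
  also have "\<dots> \<le> a 2 ^ (2 * k) + a 4 ^ k * ?i"
  proof (cases "?i = 0")
    case True
    then show ?thesis by (simp add: D)
  next
    case False
    have "a 2 ^ card ?D \<le> a 4 ^ (k - ?i)"
      unfolding D power_mult by (rule power_mono) (use a2_sq_le_a4 in auto)
    then have "a 4 ^ ?i * a 2 ^ card ?D \<le> a 4 ^ ?i * a 4 ^ (k - ?i)"
      by (intro mult_left_mono) (auto simp: a_nonneg)
    also have "\<dots> = a 4 ^ k" using i by (simp flip: power_add)
    also have "\<dots> \<le> a 4 ^ k * ?i"
      using False mult_left_mono[of 1 "real ?i" "a 4 ^ k"] a_nonneg[of 4] by simp
    also have "\<dots> \<le> a 2 ^ (2 * k) + a 4 ^ k * ?i" using a_nonneg[of 2] by simp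
    finally show ?thesis .
  qed
  finally show ?le unfolding * expectation_monomial .
qed

lemma card_partial_matchings_pos: "k \<le> n \<Longrightarrow> 0 < card (partial_matchings n k)"
  using card_partial_matchings[of n k] by (intro Nat.gr0I) auto

definition weight_sq_avg :: "nat \<Rightarrow> 'a \<Rightarrow> real" where
  "weight_sq_avg k x = (\<Sum>T\<in>partial_matchings n k. weight T x ^ 2) / card (partial_matchings n k)"

text \<open>A law of large numbers in L2. The mean is exactly \<open>a 2 ^ k\<close>, and disjoint
  pairs are uncorrelated, so the variance comes from intersecting pairs, whose contribution is
  bounded through the average overlap k^2/n^2.\<close>

lemma
  assumes k: "k \<le> n"
  shows expectation_weight_sq_avg_diff_sq_le:
      "expectation (\<lambda>x. (weight_sq_avg k x - a 2 ^ k) ^ 2) \<le> a 4 ^ k * (real k ^ 2 / real n ^ 2)" (is ?le)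
    and integrable_weight_sq_avg_diff_sq:
      "integrable M (\<lambda>x. (weight_sq_avg k x - a 2 ^ k) ^ 2)" (is ?int)
proof -
  let ?P = "partial_matchings n k"
  let ?N = "real (card ?P)"
  have N: "0 < ?N" using card_partial_matchings_pos[OF k] by simp
  have int1: "integrable M (weight_sq_avg k)"
    unfolding weight_sq_avg_def using integrable_weight_power by simp
  have E1: "expectation (weight_sq_avg k) = a 2 ^ k"
    unfolding weight_sq_avg_def using N
    by (simp add: Bochner_Integration.integral_sum integrable_weight_power expectation_weight_power)
  have sq: "weight_sq_avg k x ^ 2 = (\<Sum>T\<in>?P. \<Sum>T'\<in>?P. weight T x ^ 2 * weight T' x ^ 2) / ?N ^ 2" for x
    unfolding weight_sq_avg_def power_divide power2_eq_square[of "sum _ _"] sum_product ..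
  have int2: "integrable M (\<lambda>x. weight_sq_avg k x ^ 2)"
    unfolding sq
    by (intro integrable_divide Bochner_Integration.integrable_sum integrable_weight_sq_mult)
  have "expectation (\<lambda>x. weight_sq_avg k x ^ 2) =
      (\<Sum>T\<in>?P. \<Sum>T'\<in>?P. expectation (\<lambda>x. weight T x ^ 2 * weight T' x ^ 2)) / ?N ^ 2"
    unfolding sq by (subst integral_divide_zero, subst integral_double_sum)
      (auto intro: integrable_weight_sq_mult)
  also have "\<dots> \<le> (\<Sum>T\<in>?P. \<Sum>T'\<in>?P. a 2 ^ (2 * k) + a 4 ^ k * card (T' \<inter> T)) / ?N ^ 2"
    by (intro divide_right_mono sum_mono) (auto simp: Int_commute expectation_weight_sq_mult_le)
  also have "\<dots> = (\<Sum>T\<in>?P. ?N * a 2 ^ (2 * k) + a 4 ^ k * (real k ^ 2 / real n ^ 2 * ?N)) / ?N ^ 2"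
    using n by (intro arg_cong2[where f = "(/)"] sum.cong refl)
      (simp add: sum.distrib sum_card_Int_partial_matchings flip: sum_distrib_left)
  also have "\<dots> = a 2 ^ (2 * k) + a 4 ^ k * (real k ^ 2 / real n ^ 2)"
    using N by (simp add: power2_eq_square field_simps)
  finally have E2: "expectation (\<lambda>x. weight_sq_avg k x ^ 2) \<le> a 2 ^ (2 * k) + a 4 ^ k * (real k ^ 2 / real n ^ 2)" .
  have *: "(weight_sq_avg k x - a 2 ^ k) ^ 2 =
      weight_sq_avg k x ^ 2 - 2 * a 2 ^ k * weight_sq_avg k x + a 2 ^ (2 * k)" for x
    by (simp add: power2_diff power_mult mult.commute[of 2] flip: power_mult)
  show ?int unfolding * using int1 int2 by simp
  have "expectation (\<lambda>x. (weight_sq_avg k x - a 2 ^ k) ^ 2) =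
      expectation (\<lambda>x. weight_sq_avg k x ^ 2) - 2 * a 2 ^ k * expectation (weight_sq_avg k) + a 2 ^ (2 * k)"
    unfolding * using int1 int2 by (simp add: prob_space)
  also have "\<dots> = expectation (\<lambda>x. weight_sq_avg k x ^ 2) - a 2 ^ (2 * k)"
    unfolding E1 by (simp add: mult_2[of k] power_add)
  finally show ?le using E2 by linarith
qed

text \<open>The k-th factorial moment of the overlap under the Gibbs measure times
  \<open>ext_avg {} x ^ 2\<close>; see \<open>pair_avg_choose\<close>.\<close>

definition overlap_moment :: "nat \<Rightarrow> 'a \<Rightarrow> real" where
  "overlap_moment k x =
     (\<Sum>T\<in>partial_matchings n k. weight T x ^ 2 * ext_avg T x ^ 2) / card (partial_matchings n k)"

lemma
  assumes k: "k \<le> n" and \<eta>: "0 < \<eta>"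
  shows integrable_overlap_moment_diff:
      "integrable M (\<lambda>x. overlap_moment k x - a 2 ^ k * ext_avg {} x ^ 2)" (is ?int)
    and expectation_overlap_moment_diff_le:
      "expectation (\<lambda>x. \<bar>overlap_moment k x - a 2 ^ k * ext_avg {} x ^ 2\<bar>) \<le>
        \<eta> * (l1_const k + exp pow4_rate / 2 + a 2 ^ k * l1_const 0) +
        (l2_error k + a 4 ^ k * (real k ^ 2 / real n ^ 2) + a 2 ^ k * l2_error 0) / (2 * \<eta>)" (is ?le)
proof -
  let ?P = "partial_matchings n k"
  let ?N = "real (card ?P)"
  have N: "0 < ?N" using card_partial_matchings_pos[OF k] by simp
  define X where "X T x = weight T x ^ 2 * (ext_avg T x ^ 2 - prod_approx x ^ 2)" for T x
  have X: "integrable M (X T)" "expectation (\<lambda>x. \<bar>X T x\<bar>) \<le> \<eta> * l1_const j + l2_error j / (2 * \<eta>)"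
    if "T \<in> partial_matchings n j" for T j
    unfolding X_def using integrable_weight_sq_diff[OF that \<eta>] expectation_weight_sq_diff_le[OF that \<eta>]
    by auto
  define H where "H x = (\<Sum>T\<in>?P. \<bar>X T x\<bar>) / ?N +
      (\<eta> / 2 * prod_approx x ^ 4 + (weight_sq_avg k x - a 2 ^ k) ^ 2 / (2 * \<eta>)) +
      a 2 ^ k * \<bar>X {} x\<bar>" for x
  note [simp] = integrable_prod_approx_pow4 integrable_weight_sq_avg_diff_sq[OF k]
    X(1) X(1)[OF empty_partial_matching]
  have intH: "integrable M H" unfolding H_def by simp
  have "expectation H = (\<Sum>T\<in>?P. expectation (\<lambda>x. \<bar>X T x\<bar>)) / ?N +
      (\<eta> / 2 * expectation (\<lambda>x. prod_approx x ^ 4) +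
        expectation (\<lambda>x. (weight_sq_avg k x - a 2 ^ k) ^ 2) / (2 * \<eta>)) +
      a 2 ^ k * expectation (\<lambda>x. \<bar>X {} x\<bar>)"
    unfolding H_def by (simp add: Bochner_Integration.integral_sum)
  also have "\<dots> \<le> (\<Sum>T\<in>?P. \<eta> * l1_const k + l2_error k / (2 * \<eta>)) / ?N +
      (\<eta> / 2 * exp pow4_rate + a 4 ^ k * (real k ^ 2 / real n ^ 2) / (2 * \<eta>)) +
      a 2 ^ k * (\<eta> * l1_const 0 + l2_error 0 / (2 * \<eta>))"
    using \<eta> by (intro add_mono mult_left_mono divide_right_mono sum_mono
        expectation_prod_approx_pow4_le expectation_weight_sq_avg_diff_sq_le[OF k]
        X(2) empty_partial_matching) (auto simp: a_nonneg)
  also have "\<dots> = \<eta> * (l1_const k + exp pow4_rate / 2 + a 2 ^ k * l1_const 0) +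
        (l2_error k + a 4 ^ k * (real k ^ 2 / real n ^ 2) + a 2 ^ k * l2_error 0) / (2 * \<eta>)"
    using N by (simp add: add_divide_distrib algebra_simps)
  finally have EH: "expectation H \<le> \<dots>" .
  have le: "\<bar>overlap_moment k x - a 2 ^ k * ext_avg {} x ^ 2\<bar> \<le> H x" for x
  proof -
    \<comment> \<open>Three replacements: \<open>ext_avg T\<close> by \<open>prod_approx\<close> in
      every term, the average of squared weights by its mean, and \<open>prod_approx\<close> by
      \<open>ext_avg {}\<close>. The last is an instance of the first, at the empty partial
      matching.\<close>
    have "overlap_moment k x - a 2 ^ k * ext_avg {} x ^ 2 =
        (\<Sum>T\<in>?P. X T x) / ?N + prod_approx x ^ 2 * (weight_sq_avg k x - a 2 ^ k) - a 2 ^ k * X {} x"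
      by (simp add: overlap_moment_def weight_sq_avg_def X_def weight_def right_diff_distrib
          sum_subtractf diff_divide_distrib sum_distrib_left mult.commute)
    also have "\<bar>\<dots>\<bar> \<le> \<bar>(\<Sum>T\<in>?P. X T x) / ?N\<bar> + \<bar>prod_approx x ^ 2 * (weight_sq_avg k x - a 2 ^ k)\<bar>
        + \<bar>a 2 ^ k * X {} x\<bar>"
      by linarith
    also have "\<dots> \<le> H x"
      unfolding H_def
    proof (intro add_mono)
      show "\<bar>(\<Sum>T\<in>?P. X T x) / ?N\<bar> \<le> (\<Sum>T\<in>?P. \<bar>X T x\<bar>) / ?N"
        by (auto intro: divide_right_mono simp: abs_divide)
      have "prod_approx x ^ 4 = (prod_approx x ^ 2) ^ 2" by (simp flip: power_mult)
      then show "\<bar>prod_approx x ^ 2 * (weight_sq_avg k x - a 2 ^ k)\<bar> \<le>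
          \<eta> / 2 * prod_approx x ^ 4 + (weight_sq_avg k x - a 2 ^ k) ^ 2 / (2 * \<eta>)"
        using abs_mult_le_weighted[OF \<eta>] by metis
    qed (simp add: abs_mult a_nonneg)
    finally show ?thesis .
  qed
  have [measurable]: "weight T \<in> borel_measurable M" if "T \<in> ?P" for T
    using card_partial_matching[OF that] by measurable
  have meas: "(\<lambda>x. overlap_moment k x - a 2 ^ k * ext_avg {} x ^ 2) \<in> borel_measurable M"
    unfolding overlap_moment_def by measurable
  show ?int using integral_abs_le(1)[OF meas intH le] .
  show ?le using integral_abs_le(2)[OF meas intH le] EH by simp
qed

section \<open>Lower tail of the normalised partition function\<close>

lemma
  shows expectation_inverse_prod_approx_le: "expectation (\<lambda>x. inverse (prod_approx x)) \<le> exp (2 * var)" (is ?le)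
    and integrable_inverse_prod_approx: "integrable M (\<lambda>x. inverse (prod_approx x))" (is ?int)
    and prod_approx_pos: "0 < prod_approx x" (is ?pos)
proof -
  \<comment> \<open>The smallest possible value, at \<open>Y e x = 0\<close>, is 1 - 1/n, and
    \<open>n\<close> is at least 2.\<close>
  have half: "1 / 2 \<le> 1 + (Y e x - 1) / n" for e x
  proof -
    have "- 1 / 2 \<le> - 1 / real n" using n by (simp add: field_simps)
    also have "\<dots> \<le> (Y e x - 1) / n" using nonneg[of e x] n by (intro divide_right_mono) auto
    finally show ?thesis by linarith
  qed
  then have pos: "0 < 1 + (Y e x - 1) / n" for e x by (smt (verit) half_gt_zero)
  show ?pos unfolding prod_approx_def by (intro prod_pos ballI pos)
  have pw: "inverse (prod_approx x) = (\<Prod>e\<in>edges n. (\<lambda>y. inverse (1 + (y - 1) / n)) (Y e x))" for x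
    unfolding prod_approx_def by (rule prod_inversef[symmetric, unfolded comp_def])
  have int: "integrable M (\<lambda>x. inverse (1 + (Y e x - 1) / n))" if [measurable]: "e \<in> edges n" for e
  proof (rule integrable_const_bound[where B = 2])
    have "norm (inverse (1 + (Y e x - 1) / n)) \<le> 2" for x
      using le_imp_inverse_le[OF half[of e x]] pos[of e x] by simp
    then show "AE x in M. norm (inverse (1 + (Y e x - 1) / n)) \<le> 2" by simp
  qed measurable
  show ?int unfolding pw by (intro integrable_prod int) measurable
  \<comment> \<open>Multiplying the right side by \<open>1 + z\<close> gives 1 plus z^2 (1 + 2 z),
    which is where the bound -1/2 enters. In expectation the linear term vanishes.\<close>
  have le: "inverse (1 + z) \<le> 1 - z + 2 * z ^ 2" if "- 1 / 2 \<le> z" for z :: real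
  proof -
    have "0 \<le> z ^ 2 * (1 + 2 * z)" using that by (intro mult_nonneg_nonneg) auto
    also have "\<dots> = (1 + z) * (1 - z + 2 * z ^ 2) - 1"
      by (simp add: power2_eq_square algebra_simps)
    finally have "1 \<le> (1 + z) * (1 - z + 2 * z ^ 2)" by simp
    moreover have "0 < 1 + z" using that by simp
    ultimately show ?thesis by (simp add: inverse_eq_divide divide_le_eq mult.commute)
  qed
  have E: "expectation (\<lambda>x. inverse (1 + (Y e x - 1) / n)) \<le> 1 + 2 * var / n ^ 2"
    if e: "e \<in> edges n" for e
  proof -
    have z: "integrable M (\<lambda>x. 1 - z x / n + 2 * (z x / n) ^ 2)"
        "expectation (\<lambda>x. 1 - z x / n + 2 * (z x / n) ^ 2) =
          1 - expectation z / n + 2 * (expectation (\<lambda>x. z x ^ 2) / n ^ 2)"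
      if "integrable M z" "integrable M (\<lambda>x. z x ^ 2)" for z
      using that by (simp_all add: prob_space power_divide)
    note Y1 = expectation_Y_minus_1(1)[OF e, of 1, simplified] expectation_Y_minus_1(1)[OF e, of 2]
    have "expectation (\<lambda>x. inverse (1 + (Y e x - 1) / n)) \<le>
        expectation (\<lambda>x. 1 - (Y e x - 1) / n + 2 * ((Y e x - 1) / n) ^ 2)"
    proof (rule integral_mono[OF int[OF e] z(1)[OF Y1] le])
      show "- 1 / 2 \<le> (Y e x - 1) / n" for x using half[of e x] by linarith
    qed
    also have "\<dots> = 1 + 2 * var / n ^ 2"
      unfolding z(2)[OF Y1] using expectation_Y_minus_1(2,3)[OF e] by simp
    finally show ?thesis .
  qed
  have "expectation (\<lambda>x. inverse (prod_approx x)) =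
      (\<Prod>e\<in>edges n. expectation (\<lambda>x. inverse (1 + (Y e x - 1) / n)))"
    unfolding pw by (rule expectation_prod) (auto simp: int)
  also have "\<dots> \<le> exp (2 * var)"
  proof (rule prod_edges_le_exp[OF _ E])
    fix e show "0 \<le> expectation (\<lambda>x. inverse (1 + (Y e x - 1) / n))"
      using pos[of e] by (intro Bochner_Integration.integral_nonneg) (simp add: less_imp_le)
  qed
  finally show ?le .
qed

text \<open>If \<open>ext_avg {}\<close> is at most \<delta>, then it differs from
  \<open>prod_approx\<close> by at least \<delta> or \<open>prod_approx\<close> is at most 2
  \<delta>. Markov's inequality handles the first event through the L2 error, the second through the
  mean of the inverse.\<close>

lemma prob_ext_avg_le:
  assumes \<delta>: "0 < \<delta>"
  shows "prob {x \<in> space M. ext_avg {} x \<le> \<delta>} \<le> l2_error 0 / \<delta> ^ 2 + 2 * \<delta> * exp (2 * var)"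
proof -
  let ?A = "{x \<in> space M. \<delta> ^ 2 \<le> (ext_avg {} x - prod_approx x) ^ 2}"
  let ?B = "{x \<in> space M. 1 / (2 * \<delta>) \<le> inverse (prod_approx x)}"
  have "{x \<in> space M. ext_avg {} x \<le> \<delta>} \<subseteq> ?A \<union> ?B"
  proof (intro subsetI, rule ccontr)
    fix x assume x: "x \<in> {x \<in> space M. ext_avg {} x \<le> \<delta>}" and no: "x \<notin> ?A \<union> ?B"
    then have "inverse (prod_approx x) < inverse (2 * \<delta>)" by (simp add: inverse_eq_divide)
    then have "2 * \<delta> < prod_approx x"
      by (rule inverse_less_imp_less) (use prod_approx_pos in auto)
    then have "\<delta> \<le> \<bar>ext_avg {} x - prod_approx x\<bar>" using x by auto
    then have "\<delta> ^ 2 \<le> \<bar>ext_avg {} x - prod_approx x\<bar> ^ 2" using \<delta> by (intro power_mono) auto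
    then show False using x no by simp
  qed
  then have "prob {x \<in> space M. ext_avg {} x \<le> \<delta>} \<le> prob (?A \<union> ?B)"
    by (intro finite_measure_mono) measurable
  also have "\<dots> \<le> prob ?A + prob ?B" by (intro measure_Un_le) measurable
  also have "prob ?A \<le> expectation (\<lambda>x. (ext_avg {} x - prod_approx x) ^ 2) / \<delta> ^ 2"
    using \<delta> integrable_ext_avg_minus_prod_approx_sq[OF empty_partial_matching]
    by (intro integral_Markov_inequality_measure[where A = "{}"]) auto
  also have "\<dots> \<le> l2_error 0 / \<delta> ^ 2"
    by (intro divide_right_mono expectation_ext_avg_minus_prod_approx_sq_le[OF empty_partial_matching]) simp
  also have "prob ?B \<le> expectation (\<lambda>x. inverse (prod_approx x)) / (1 / (2 * \<delta>))"
    using \<delta> prod_approx_pos integrable_inverse_prod_approx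
    by (intro integral_Markov_inequality_measure[where A = "{}"]) (auto intro: less_imp_le)
  also have "\<dots> \<le> exp (2 * var) / (1 / (2 * \<delta>))"
    using \<delta> by (intro divide_right_mono expectation_inverse_prod_approx_le) simp
  finally show ?thesis by (simp add: mult.commute)
qed

section \<open>Averages over pairs of matchings\<close>

definition pair_avg :: "(nat \<Rightarrow> real) \<Rightarrow> 'a \<Rightarrow> real" where
  "pair_avg h x = (\<Sum>\<pi>\<in>perfect_matchings n. \<Sum>\<pi>'\<in>perfect_matchings n.
     h (card (\<pi> \<inter> \<pi>')) * (weight \<pi> x * weight \<pi>' x)) / fact n ^ 2"

text \<open>Fixes the normalisation: where \<open>ext_avg {}\<close> is nonzero,
  \<open>pair_avg h\<close> is its square times the Gibbs expectation of \<open>h\<close> of the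
  overlap. Being polynomial in the weights, \<open>pair_avg h\<close> has a computable
  expectation.\<close>

lemma pair_avg_1: "pair_avg (\<lambda>_. 1) x = ext_avg {} x ^ 2"
  unfolding pair_avg_def ext_avg_def by (simp add: power_divide power2_eq_square sum_product)

text \<open>The binomial coefficient counts the partial matchings \<open>T\<close> contained in both
  matchings. After the sums are exchanged, the terms of a fixed \<open>T\<close> form the square of
  one sum over its extensions.\<close>

lemma pair_avg_choose:
  assumes k: "k \<le> n"
  shows "pair_avg (\<lambda>N. real (N choose k)) x = overlap_moment k x / fact k"
proof -
  let ?P = "perfect_matchings n" and ?Q = "partial_matchings n k"
  let ?F = "fact (n - k) :: real"
  let ?N = "real (card ?Q)"
  have N: "0 < ?N" using card_partial_matchings_pos[OF k] by simp
  have choose: "real (card (\<pi> \<inter> \<pi>') choose k) = (\<Sum>T\<in>?Q. of_bool (T \<subseteq> \<pi>) * of_bool (T \<subseteq> \<pi>'))"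
    if "\<pi> \<in> ?P" for \<pi> \<pi>'
  proof -
    have "(\<Sum>T\<in>?Q. of_bool (T \<subseteq> \<pi>) * of_bool (T \<subseteq> \<pi>')) = (\<Sum>T\<in>?Q. of_bool (T \<subseteq> \<pi> \<inter> \<pi>') :: real)"
      by (intro sum.cong) auto
    also have "\<dots> = real (card (?Q \<inter> {T. T \<subseteq> \<pi> \<inter> \<pi>'}))"
      by (simp add: of_bool_def sum.If_cases finite_partial_matchings)
    also have "?Q \<inter> {T. T \<subseteq> \<pi> \<inter> \<pi>'} = {T. T \<subseteq> \<pi> \<inter> \<pi>' \<and> card T = k}"
      using that by (auto simp: partial_matchings_def)
    also have "card \<dots> = card (\<pi> \<inter> \<pi>') choose k"
      using card_perfect_matching[OF that] by (intro n_subsets) simp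
    finally show ?thesis by simp
  qed
  have inner: "(\<Sum>\<pi>\<in>?P. of_bool (T \<subseteq> \<pi>) * weight \<pi> x) = ?F * (weight T x * ext_avg T x)"
    if T: "T \<in> ?Q" for T
  proof -
    have "(\<Sum>\<pi>\<in>?P. of_bool (T \<subseteq> \<pi>) * weight \<pi> x) = (\<Sum>\<pi> | \<pi> \<in> ?P \<and> T \<subseteq> \<pi>. weight \<pi> x)"
      by (simp add: of_bool_def if_distrib[of "\<lambda>u. u * _"] sum.inter_filter finite_perfect_matchings cong: if_cong)
    also have "\<dots> = (\<Sum>\<pi> | \<pi> \<in> ?P \<and> T \<subseteq> \<pi>. weight T x * weight (\<pi> - T) x)"
    proof (intro sum.cong refl)
      fix \<pi> assume "\<pi> \<in> {\<pi> \<in> ?P. T \<subseteq> \<pi>}"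
      then have "T \<subseteq> \<pi>" "finite \<pi>" using card_perfect_matching(1) by auto
      then show "weight \<pi> x = weight T x * weight (\<pi> - T) x"
        unfolding weight_def by (simp add: prod.subset_diff[of T \<pi>] mult.commute)
    qed
    also have "\<dots> = ?F * (weight T x * ext_avg T x)"
      unfolding sum_distrib_left[symmetric] using card_partial_matching[OF T] by (simp add: ext_avg_def)
    finally show ?thesis .
  qed
  have "(\<Sum>\<pi>\<in>?P. \<Sum>\<pi>'\<in>?P. real (card (\<pi> \<inter> \<pi>') choose k) * (weight \<pi> x * weight \<pi>' x)) =
    (\<Sum>\<pi>\<in>?P. \<Sum>\<pi>'\<in>?P. \<Sum>T\<in>?Q. (of_bool (T \<subseteq> \<pi>) * weight \<pi> x) * (of_bool (T \<subseteq> \<pi>') * weight \<pi>' x))"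
    by (intro sum.cong refl) (simp add: choose sum_distrib_left sum_distrib_right ac_simps)
  also have "\<dots> = (\<Sum>\<pi>\<in>?P. \<Sum>T\<in>?Q. \<Sum>\<pi>'\<in>?P. (of_bool (T \<subseteq> \<pi>) * weight \<pi> x) * (of_bool (T \<subseteq> \<pi>') * weight \<pi>' x))"
    by (intro sum.cong refl sum.swap)
  also have "\<dots> = (\<Sum>T\<in>?Q. \<Sum>\<pi>\<in>?P. \<Sum>\<pi>'\<in>?P. (of_bool (T \<subseteq> \<pi>) * weight \<pi> x) * (of_bool (T \<subseteq> \<pi>') * weight \<pi>' x))"
    by (rule sum.swap)
  also have "\<dots> = (\<Sum>T\<in>?Q. (?F * (weight T x * ext_avg T x)) ^ 2)"
    by (intro sum.cong refl) (simp only: power2_eq_square inner[symmetric] sum_product)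
  also have "\<dots> = ?F ^ 2 * (?N * overlap_moment k x)"
    using N by (simp add: overlap_moment_def power_mult_distrib flip: sum_distrib_left)
  also have "\<dots> = fact n ^ 2 * (overlap_moment k x / fact k)"
  proof -
    have "?F * ?N = fact n * real (n choose k)" by (rule card_partial_matchings)
    then have "?F ^ 2 * ?N = fact n * (?F * real (n choose k))" by (simp add: power2_eq_square)
    also have "?F * real (n choose k) = fact n / fact k" using k by (simp add: binomial_fact)
    finally have "?F ^ 2 * ?N = fact n ^ 2 / fact k" by (simp add: power2_eq_square)
    then show ?thesis by (simp add: mult.assoc[symmetric])
  qed
  finally show ?thesis by (simp add: pair_avg_def)
qed

lemma integrable_pair_avg: "integrable M (pair_avg h)"
proof -
  have "integrable M (\<lambda>x. weight \<pi> x * weight \<pi>' x)"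
    if "\<pi> \<in> perfect_matchings n" "\<pi>' \<in> perfect_matchings n" for \<pi> \<pi>'
    using integrable_weights[of "{}" \<pi> \<pi>' 0] that by (simp add: perfect_matching_edges)
  then show ?thesis unfolding pair_avg_def
    by (intro integrable_divide Bochner_Integration.integrable_sum integrable_mult_right) auto
qed

text \<open>Each common edge carries \<open>c\<close> in addition to the second moment
  \<open>a 2\<close>, so the counting bound applies with 1 + s = c * a 2.\<close>

lemma expectation_pair_avg_power_le:
  assumes c: "1 \<le> c"
  shows "expectation (pair_avg (\<lambda>N. c ^ N)) \<le> exp (c * a 2 - 1)"
proof -
  let ?P = "perfect_matchings n"
  define s where "s = c * a 2 - 1"
  have s: "0 \<le> s" using mult_mono[OF c one_le_a2] c by (simp add: s_def)
  have "expectation (pair_avg (\<lambda>N. c ^ N)) = (\<Sum>\<pi>\<in>?P. \<Sum>\<pi>'\<in>?P.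
      expectation (\<lambda>x. c ^ card (\<pi> \<inter> \<pi>') * (weight \<pi> x * weight \<pi>' x))) / fact n ^ 2"
    unfolding pair_avg_def
  proof (subst integral_divide_zero, subst integral_double_sum)
    fix \<pi> \<pi>' assume "\<pi> \<in> ?P" "\<pi>' \<in> ?P"
    then show "integrable M (\<lambda>x. c ^ card (\<pi> \<inter> \<pi>') * (weight \<pi> x * weight \<pi>' x))"
      using integrable_weights[of "{}" \<pi> \<pi>' 0] by (simp add: perfect_matching_edges)
  qed simp
  also have "\<dots> = (\<Sum>\<pi>\<in>?P. \<Sum>\<pi>'\<in>?P. (1 + s) ^ card (\<pi> \<inter> \<pi>')) / fact n ^ 2"
    using expectation_weights[of "{}" _ _ 0]
    by (intro arg_cong2[where f = "(/)"] sum.cong refl)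
      (simp add: perfect_matching_edges s_def power_mult_distrib)
  also have "\<dots> \<le> (\<Sum>\<pi>\<in>?P. fact n * exp s) / fact n ^ 2"
    using sum_perfect_matchings_power_overlap_le[where T = "{}" and t = s and n = n] s
    by (intro divide_right_mono sum_mono) auto
  also have "\<dots> = exp s" by (simp add: card_perfect_matchings power2_eq_square)
  finally show ?thesis by (simp add: s_def)
qed

lemma pair_avg_mult: "pair_avg (\<lambda>N. c * h N) x = c * pair_avg h x"
  by (simp add: pair_avg_def sum_distrib_left mult.assoc)

lemma abs_pair_avg_le:
  assumes "\<And>N. \<bar>g N\<bar> \<le> h N"
  shows "\<bar>pair_avg g x\<bar> \<le> pair_avg h x"
proof -
  let ?P = "perfect_matchings n"
  let ?w = "\<lambda>\<pi> \<pi>'. weight \<pi> x * weight \<pi>' x"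
  have "\<bar>g (card (\<pi> \<inter> \<pi>')) * ?w \<pi> \<pi>'\<bar> \<le> h (card (\<pi> \<inter> \<pi>')) * ?w \<pi> \<pi>'" for \<pi> \<pi>'
    using assms weight_nonneg by (simp add: abs_mult mult_right_mono)
  then have "\<bar>\<Sum>\<pi>'\<in>?P. g (card (\<pi> \<inter> \<pi>')) * ?w \<pi> \<pi>'\<bar> \<le>
      (\<Sum>\<pi>'\<in>?P. h (card (\<pi> \<inter> \<pi>')) * ?w \<pi> \<pi>')" for \<pi>
    by (rule abs_sum_le)
  then have "\<bar>\<Sum>\<pi>\<in>?P. \<Sum>\<pi>'\<in>?P. g (card (\<pi> \<inter> \<pi>')) * ?w \<pi> \<pi>'\<bar> \<le>
      (\<Sum>\<pi>\<in>?P. \<Sum>\<pi>'\<in>?P. h (card (\<pi> \<inter> \<pi>')) * ?w \<pi> \<pi>')"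
    by (rule abs_sum_le)
  then show ?thesis unfolding pair_avg_def by (simp add: abs_divide divide_right_mono)
qed

text \<open>Three errors add up: the Newton remainder, controlled by the mean of 5^N; the first
  \<open>L\<close> factorial moments; and the truncation of the Poisson series. The condition
  \<open>L \<le> n\<close> makes \<open>pair_avg_choose\<close> available for every k below
  \<open>L\<close>.\<close>

lemma expectation_pair_avg_poisson_le:
  assumes B: "\<And>m. \<bar>f m\<bar> \<le> B" and L: "L \<le> n"
  defines "p \<equiv> measure_pmf.expectation (poisson_pmf (a 2)) f"
  shows "expectation (\<lambda>x. \<bar>pair_avg f x - p * ext_avg {} x ^ 2\<bar>) \<le>
      B / 2 ^ L * exp (5 * a 2 - 1) +
      (\<Sum>k<L. \<bar>newton_coeff f k\<bar> / fact k *
        expectation (\<lambda>x. \<bar>overlap_moment k x - a 2 ^ k * ext_avg {} x ^ 2\<bar>)) +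
      \<bar>(\<Sum>k<L. newton_coeff f k * (a 2 ^ k / fact k)) - p\<bar> * exp var" (is "_ \<le> ?R")
    and "integrable M (\<lambda>x. pair_avg f x - p * ext_avg {} x ^ 2)"
proof -
  let ?c = "newton_coeff f"
  let ?s = "\<Sum>k<L. ?c k * (a 2 ^ k / fact k)"
  define X where "X k x = overlap_moment k x - a 2 ^ k * ext_avg {} x ^ 2" for k x
  have X [simp]: "integrable M (X k)" if "k < L" for k
    unfolding X_def using integrable_overlap_moment_diff[of k 1] that L by simp
  have [simp]: "integrable M (\<lambda>x. ext_avg {} x ^ 2)"
    using integrable_pair_avg[of "\<lambda>_. 1"] by (simp add: pair_avg_1[abs_def])
  note [simp] = integrable_pair_avg
  define H where "H x = B / 2 ^ L * pair_avg (\<lambda>N. 5 ^ N) x + (\<Sum>k<L. \<bar>?c k\<bar> / fact k * \<bar>X k x\<bar>) +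
      \<bar>?s - p\<bar> * ext_avg {} x ^ 2" for x
  have intH: "integrable M H" unfolding H_def by (intro Bochner_Integration.integrable_add) auto
  have lin: "pair_avg f x - (\<Sum>k<L. ?c k * pair_avg (\<lambda>N. real (N choose k)) x) =
      pair_avg (\<lambda>N. f N - (\<Sum>k<L. real (N choose k) * ?c k)) x" for x
  proof -
    let ?w = "\<lambda>\<pi> \<pi>'. weight \<pi> x * weight \<pi>' x"
    have "(\<Sum>k<L. ?c k * pair_avg (\<lambda>N. real (N choose k)) x) =
       (\<Sum>k<L. \<Sum>\<pi>\<in>perfect_matchings n. \<Sum>\<pi>'\<in>perfect_matchings n.
          real (card (\<pi> \<inter> \<pi>') choose k) * ?c k * ?w \<pi> \<pi>') / fact n ^ 2"
      by (simp add: pair_avg_def sum_distrib_left sum_divide_distrib ac_simps)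
    also have "\<dots> = (\<Sum>\<pi>\<in>perfect_matchings n. \<Sum>k<L. \<Sum>\<pi>'\<in>perfect_matchings n.
          real (card (\<pi> \<inter> \<pi>') choose k) * ?c k * ?w \<pi> \<pi>') / fact n ^ 2"
      by (intro arg_cong2[where f = "(/)"] sum.swap refl)
    also have "\<dots> = (\<Sum>\<pi>\<in>perfect_matchings n. \<Sum>\<pi>'\<in>perfect_matchings n. \<Sum>k<L.
          real (card (\<pi> \<inter> \<pi>') choose k) * ?c k * ?w \<pi> \<pi>') / fact n ^ 2"
      by (intro arg_cong2[where f = "(/)"] sum.cong sum.swap refl)
    also have "\<dots> = pair_avg (\<lambda>N. \<Sum>k<L. real (N choose k) * ?c k) x"
      unfolding pair_avg_def by (simp add: sum_distrib_right)
    finally show ?thesis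
      by (simp add: pair_avg_def left_diff_distrib sum_subtractf diff_divide_distrib)
  qed
  have le: "\<bar>pair_avg f x - p * ext_avg {} x ^ 2\<bar> \<le> H x" for x
  proof -
    have eq: "pair_avg f x - p * ext_avg {} x ^ 2 =
       pair_avg (\<lambda>N. f N - (\<Sum>k<L. real (N choose k) * ?c k)) x +
       (\<Sum>k<L. ?c k / fact k * X k x) + (?s - p) * ext_avg {} x ^ 2"
    proof -
      have "(\<Sum>k<L. ?c k * pair_avg (\<lambda>N. real (N choose k)) x) =
          (\<Sum>k<L. ?c k / fact k * X k x) + ?s * ext_avg {} x ^ 2"
        unfolding sum_distrib_right sum.distrib[symmetric]
        using L by (intro sum.cong refl) (simp add: pair_avg_choose X_def field_simps)
      then show ?thesis unfolding lin[symmetric] by (simp add: left_diff_distrib)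
    qed
    have "\<bar>pair_avg f x - p * ext_avg {} x ^ 2\<bar> \<le> \<bar>pair_avg (\<lambda>N. f N - (\<Sum>k<L. real (N choose k) * ?c k)) x\<bar> +
       \<bar>\<Sum>k<L. ?c k / fact k * X k x\<bar> + \<bar>(?s - p) * ext_avg {} x ^ 2\<bar>"
      unfolding eq by linarith
    also have "\<dots> \<le> H x" unfolding H_def
    proof (intro add_mono)
      have "\<bar>pair_avg (\<lambda>N. f N - (\<Sum>k<L. real (N choose k) * ?c k)) x\<bar> \<le>
          pair_avg (\<lambda>N. B / 2 ^ L * 5 ^ N) x"
        using newton_truncation[of f B, OF B] by (rule abs_pair_avg_le)
      also have "\<dots> = B / 2 ^ L * pair_avg (\<lambda>N. 5 ^ N) x"
        by (rule pair_avg_mult)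
      finally show "\<bar>pair_avg (\<lambda>N. f N - (\<Sum>k<L. real (N choose k) * ?c k)) x\<bar> \<le>
          B / 2 ^ L * pair_avg (\<lambda>N. 5 ^ N) x" .
      show "\<bar>\<Sum>k<L. ?c k / fact k * X k x\<bar> \<le> (\<Sum>k<L. \<bar>?c k\<bar> / fact k * \<bar>X k x\<bar>)"
        by (rule order_trans[OF sum_abs]) (simp add: abs_mult)
    qed (simp add: abs_mult)
    finally show ?thesis .
  qed
  have meas: "(\<lambda>x. pair_avg f x - p * ext_avg {} x ^ 2) \<in> borel_measurable M"
    using borel_measurable_integrable[OF integrable_pair_avg[of f]] by measurable
  show "integrable M (\<lambda>x. pair_avg f x - p * ext_avg {} x ^ 2)"
    using integral_abs_le(1)[OF meas intH le] .
  have "expectation (\<lambda>x. \<bar>pair_avg f x - p * ext_avg {} x ^ 2\<bar>) \<le> expectation H"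
    using integral_abs_le(2)[OF meas intH le] .
  also have "expectation H = B / 2 ^ L * expectation (pair_avg (\<lambda>N. 5 ^ N)) +
      (\<Sum>k<L. \<bar>?c k\<bar> / fact k * expectation (\<lambda>x. \<bar>X k x\<bar>)) +
      \<bar>?s - p\<bar> * expectation (\<lambda>x. ext_avg {} x ^ 2)"
  proof -
    have "integrable M (\<lambda>x. B / 2 ^ L * pair_avg (\<lambda>N. 5 ^ N) x)"
      "integrable M (\<lambda>x. \<Sum>k<L. \<bar>?c k\<bar> / fact k * \<bar>X k x\<bar>)"
      "integrable M (\<lambda>x. \<bar>?s - p\<bar> * ext_avg {} x ^ 2)"
      by (intro integrable_mult_right Bochner_Integration.integrable_sum integrable_abs; simp)+
    then have "expectation H = expectation (\<lambda>x. B / 2 ^ L * pair_avg (\<lambda>N. 5 ^ N) x) +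
        expectation (\<lambda>x. \<Sum>k<L. \<bar>?c k\<bar> / fact k * \<bar>X k x\<bar>) +
        expectation (\<lambda>x. \<bar>?s - p\<bar> * ext_avg {} x ^ 2)"
      unfolding H_def by (simp only: Bochner_Integration.integral_add Bochner_Integration.integrable_add)
    also have "expectation (\<lambda>x. \<Sum>k<L. \<bar>?c k\<bar> / fact k * \<bar>X k x\<bar>) =
        (\<Sum>k<L. expectation (\<lambda>x. \<bar>?c k\<bar> / fact k * \<bar>X k x\<bar>))"
      by (intro Bochner_Integration.integral_sum integrable_mult_right integrable_abs) simp
    finally show ?thesis by (simp only: integral_mult_right_zero)
  qed
  also have "\<dots> \<le> ?R"
  proof -
    have "0 \<le> B" using B[of 0] by simp
    moreover have "expectation (\<lambda>x. ext_avg {} x ^ 2) \<le> exp var"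
      using expectation_weight_ext_avg_sq_le[OF empty_partial_matching, of 0] by (simp add: a_0)
    ultimately show ?thesis unfolding X_def
      by (intro add_mono mult_left_mono order_refl expectation_pair_avg_power_le) auto
  qed
  finally show "expectation (\<lambda>x. \<bar>pair_avg f x - p * ext_avg {} x ^ 2\<bar>) \<le> ?R" .
qed

text \<open>\<open>J\<close> stands for the Gibbs expectation of \<open>f\<close> of the overlap.
  Where \<open>ext_avg {}\<close> exceeds \<delta>, an error above \<open>e\<close> in this quotient
  forces an error of at least e \<delta>^2 before division, to which Markov's inequality
  applies.\<close>

lemma prob_quotient_deviation_le:
  assumes [measurable]: "J \<in> borel_measurable M"
    and J: "AE x in M. ext_avg {} x \<noteq> 0 \<longrightarrow> J x * ext_avg {} x ^ 2 = pair_avg f x"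
    and int: "integrable M (\<lambda>x. pair_avg f x - p * ext_avg {} x ^ 2)"
    and pos: "0 < \<delta>" "0 < e"
  shows "prob {x \<in> space M. \<bar>J x - p\<bar> > e} \<le>
    l2_error 0 / \<delta> ^ 2 + 2 * \<delta> * exp (2 * var) +
    expectation (\<lambda>x. \<bar>pair_avg f x - p * ext_avg {} x ^ 2\<bar>) / (e * \<delta> ^ 2)"
proof -
  let ?X = "\<lambda>x. \<bar>pair_avg f x - p * ext_avg {} x ^ 2\<bar>"
  let ?A = "{x \<in> space M. ext_avg {} x \<le> \<delta>}"
  let ?B = "{x \<in> space M. e * \<delta> ^ 2 \<le> ?X x}"
  note [measurable] = borel_measurable_integrable[OF integrable_pair_avg]
  have "AE x in M. x \<in> {x \<in> space M. \<bar>J x - p\<bar> > e} \<longrightarrow> x \<in> ?A \<union> ?B"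
    using J
  proof eventually_elim
    case (elim x)
    show ?case
    proof (intro impI, rule ccontr)
      assume x: "x \<in> {x \<in> space M. \<bar>J x - p\<bar> > e}" and no: "x \<notin> ?A \<union> ?B"
      then have Z: "\<delta> < ext_avg {} x" by auto
      then have "\<delta> ^ 2 \<le> ext_avg {} x ^ 2" using pos by (intro power_mono) auto
      then have "e * \<delta> ^ 2 \<le> \<bar>J x - p\<bar> * ext_avg {} x ^ 2"
        using x pos by (intro mult_mono) auto
      also have "\<dots> = \<bar>(J x - p) * ext_avg {} x ^ 2\<bar>" by (simp add: abs_mult)
      also have "(J x - p) * ext_avg {} x ^ 2 = pair_avg f x - p * ext_avg {} x ^ 2"
        using elim Z pos by (simp add: left_diff_distrib)
      finally show False using no x by simp
    qed
  qed
  then have "prob {x \<in> space M. \<bar>J x - p\<bar> > e} \<le> prob (?A \<union> ?B)"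
    by (rule finite_measure_mono_AE) measurable
  also have "\<dots> \<le> prob ?A + prob ?B" by (intro measure_Un_le) measurable
  also have "prob ?B \<le> expectation ?X / (e * \<delta> ^ 2)"
    using pos by (intro integral_Markov_inequality_measure[where A = "{}"] integrable_abs int) auto
  also have "prob ?A \<le> l2_error 0 / \<delta> ^ 2 + 2 * \<delta> * exp (2 * var)" by (rule prob_ext_avg_le) fact
  finally show ?thesis by simp
qed

end

section \<open>Limits\<close>

text \<open>First \<eta> makes the first summand at most half of the target, then \<open>n\<close>
  is taken large for the second. The 1 added to the absolute value of \<open>A\<close> keeps the
  denominator of \<eta> positive.\<close>

lemma tendsto_0_tradeoff:
  fixes f g :: "nat \<Rightarrow> real"
  assumes f: "\<And>n. 0 \<le> f n" and g: "g \<longlonglongrightarrow> 0"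
    and le: "\<And>\<eta>. 0 < \<eta> \<Longrightarrow> eventually (\<lambda>n. f n \<le> \<eta> * A + g n / \<eta>) sequentially"
  shows "f \<longlonglongrightarrow> 0"
proof (rule order_tendstoI)
  fix e :: real assume e: "0 < e"
  define \<eta> where "\<eta> = e / (2 * (\<bar>A\<bar> + 1))"
  have \<eta>: "0 < \<eta>" using e by (simp add: \<eta>_def)
  have "\<eta> * A \<le> \<eta> * (\<bar>A\<bar> + 1)" using \<eta> by (intro mult_left_mono) auto
  also have "\<dots> = e / 2" by (simp add: \<eta>_def field_simps add_pos_nonneg)
  finally have A: "\<eta> * A \<le> e / 2" .
  have "(\<lambda>n. g n / \<eta>) \<longlonglongrightarrow> 0 / \<eta>" using g by (intro tendsto_divide) (use \<eta> in auto)
  then have "eventually (\<lambda>n. g n / \<eta> < e / 2) sequentially"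
    using e by (intro order_tendstoD) auto
  with le[OF \<eta>] show "eventually (\<lambda>n. f n < e) sequentially"
    by eventually_elim (use A in linarith)
next
  fix e :: real assume "e < 0"
  then show "eventually (\<lambda>n. e < f n) sequentially" using f by (intro always_eventually) (smt (verit))
qed

lemma one_plus_over_power_tendsto:
  fixes t :: real
  shows "(\<lambda>n. (1 + t / real n) ^ (n - k)) \<longlonglongrightarrow> exp t"
proof -
  have 1: "(\<lambda>n. 1 + t / real n) \<longlonglongrightarrow> 1 + 0" by (intro tendsto_intros lim_const_over_n)
  \<comment> \<open>Lowering the exponent by the fixed \<open>k\<close> is division by a power with
    limit 1, valid once the base is positive.\<close>
  have "(\<lambda>n. (1 + t / real n) ^ n / (1 + t / real n) ^ k) \<longlonglongrightarrow> exp t / (1 + 0) ^ k"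
    by (intro tendsto_divide tendsto_power 1 tendsto_exp_limit_sequentially) simp
  moreover have "eventually (\<lambda>n. (1 + t / real n) ^ n / (1 + t / real n) ^ k = (1 + t / real n) ^ (n - k)) sequentially"
  proof -
    have "eventually (\<lambda>n. 0 < 1 + t / real n) sequentially" using 1 by (intro order_tendstoD) auto
    moreover have "eventually (\<lambda>n. k \<le> n) sequentially" by (rule eventually_ge_at_top)
    ultimately show ?thesis
      by eventually_elim (subst power_diff, auto)
  qed
  ultimately show ?thesis using Lim_transform_eventually by force
qed

lemma square_ratio_tendsto_0: "(\<lambda>n. c * (real k ^ 2 / real n ^ 2)) \<longlonglongrightarrow> 0"
proof -
  have "(\<lambda>n. c * (real k / real n) ^ 2) \<longlonglongrightarrow> c * 0 ^ 2"
    by (intro tendsto_intros lim_const_over_n)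
  then show ?thesis by (simp add: power_divide)
qed


text \<open>The probability spaces may vary with \<open>n\<close>, while the moments
  \<open>a\<close> are common to all.\<close>

context
  fixes M :: "nat \<Rightarrow> 'a measure" and Y :: "nat \<Rightarrow> nat \<times> nat \<Rightarrow> 'a \<Rightarrow> real" and a :: "nat \<Rightarrow> real"
  assumes iid: "\<And>n. 2 \<le> n \<Longrightarrow> iid_edge_weights (M n) n (Y n) a"
begin

lemma l2_error_tendsto: "(\<lambda>n. iid_edge_weights.l2_error n a k) \<longlonglongrightarrow> 0"
proof -
  \<comment> \<open>The instance at 2 provides \<open>var\<close>, which depends on \<open>a\<close>
    only; quantities that depend on \<open>n\<close> keep their qualified names.\<close>
  interpret iid_edge_weights "M 2" 2 "Y 2" a by (rule iid) simp
  have "(\<lambda>n. 2 * exp var - 2 * (1 + var / real n) ^ (n - k)) \<longlonglongrightarrow> 2 * exp var - 2 * exp var"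
    by (intro tendsto_intros one_plus_over_power_tendsto)
  moreover have "eventually (\<lambda>n. 2 * exp var - 2 * (1 + var / real n) ^ (n - k) =
      iid_edge_weights.l2_error n a k) sequentially"
    using eventually_ge_at_top[of 2]
    by eventually_elim (simp add: iid_edge_weights.l2_error_def[OF iid])
  ultimately show ?thesis using Lim_transform_eventually by fastforce
qed

lemma overlap_moment_tendsto:
  "(\<lambda>n. \<integral>x. \<bar>iid_edge_weights.overlap_moment n (Y n) k x -
     a 2 ^ k * iid_edge_weights.ext_avg n (Y n) {} x ^ 2\<bar> \<partial>M n) \<longlonglongrightarrow> 0"
proof -
  interpret iid_edge_weights "M 2" 2 "Y 2" a by (rule iid) simp
  let ?l2_error = "\<lambda>n k. iid_edge_weights.l2_error n a k"
  define g where "g n = (?l2_error n k + a 4 ^ k * (real k ^ 2 / real n ^ 2) + a 2 ^ k * ?l2_error n 0) / 2" for n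
  have "g \<longlonglongrightarrow> (0 + 0 + a 2 ^ k * 0) / 2"
    unfolding g_def
    by (intro tendsto_divide tendsto_add tendsto_mult tendsto_const l2_error_tendsto square_ratio_tendsto_0) simp
  then have g: "g \<longlonglongrightarrow> 0" by simp
  show ?thesis
  proof (rule tendsto_0_tradeoff[where g = g and A = "l1_const k + exp pow4_rate / 2 + a 2 ^ k * l1_const 0"])
    fix \<eta> :: real assume \<eta>: "0 < \<eta>"
    show "eventually (\<lambda>n. (\<integral>x. \<bar>iid_edge_weights.overlap_moment n (Y n) k x -
        a 2 ^ k * iid_edge_weights.ext_avg n (Y n) {} x ^ 2\<bar> \<partial>M n) \<le>
        \<eta> * (l1_const k + exp pow4_rate / 2 + a 2 ^ k * l1_const 0) + g n / \<eta>) sequentially"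
      using eventually_ge_at_top[of 2] eventually_ge_at_top[of k]
    proof eventually_elim
      case (elim n)
      have "g n / \<eta> = (?l2_error n k + a 4 ^ k * (real k ^ 2 / real n ^ 2) + a 2 ^ k * ?l2_error n 0) / (2 * \<eta>)"
        by (simp add: g_def)
      then show ?case
        using iid_edge_weights.expectation_overlap_moment_diff_le[OF iid[OF elim(1)] elim(2) \<eta>]
        by simp
    qed
  qed (use g in auto)
qed

lemma pair_avg_poisson_tendsto:
  assumes B: "\<And>m. \<bar>f m\<bar> \<le> B"
  defines "p \<equiv> measure_pmf.expectation (poisson_pmf (a 2)) f"
  shows "(\<lambda>n. \<integral>x. \<bar>iid_edge_weights.pair_avg n (Y n) f x -
     p * iid_edge_weights.ext_avg n (Y n) {} x ^ 2\<bar> \<partial>M n) \<longlonglongrightarrow> 0" (is "?q \<longlonglongrightarrow> 0")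
proof -
  interpret iid_edge_weights "M 2" 2 "Y 2" a by (rule iid) simp
  let ?D = "\<lambda>k n. \<integral>x. \<bar>iid_edge_weights.overlap_moment n (Y n) k x -
     a 2 ^ k * iid_edge_weights.ext_avg n (Y n) {} x ^ 2\<bar> \<partial>M n"
  let ?c = "newton_coeff f"
  \<comment> \<open>The part of the bound free of \<open>n\<close>. It is made small by the choice
    of \<open>L\<close>, after which finitely many moment errors tend to 0.\<close>
  define r where "r L = B / 2 ^ L * exp (5 * a 2 - 1) +
    \<bar>(\<Sum>k<L. ?c k * (a 2 ^ k / fact k)) - p\<bar> * exp var" for L
  have "(\<lambda>L. \<Sum>k<L. ?c k * (a 2 ^ k / fact k)) \<longlonglongrightarrow> p"
    using newton_poisson_sums[of "a 2" f B, OF _ B] one_le_a2 by (simp add: sums_def p_def)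
  then have "(\<lambda>L. \<bar>(\<Sum>k<L. ?c k * (a 2 ^ k / fact k)) - p\<bar>) \<longlonglongrightarrow> 0"
    by (simp add: LIM_zero_iff tendsto_rabs_zero_iff)
  moreover have "(\<lambda>L. B / 2 ^ L) \<longlonglongrightarrow> 0"
    using tendsto_mult[OF tendsto_const[of B] LIMSEQ_power_zero[of "1 / 2 :: real"]]
    by (simp add: power_divide)
  ultimately have "r \<longlonglongrightarrow> 0 * exp (5 * a 2 - 1) + 0 * exp var"
    unfolding r_def by (intro tendsto_intros)
  then have r: "r \<longlonglongrightarrow> 0" by simp
  show ?thesis
  proof (rule order_tendstoI)
    fix e :: real assume "e < 0"
    moreover have "0 \<le> ?q n" for n by simp
    ultimately show "eventually (\<lambda>n. e < ?q n) sequentially"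
      by (intro always_eventually allI) (rule less_le_trans)
  next
    fix e :: real assume e: "0 < e"
    then have "eventually (\<lambda>L. r L < e / 2) sequentially" using r by (intro order_tendstoD) auto
    then obtain L where L: "r L < e / 2" by (auto simp: eventually_sequentially)
    have "(\<lambda>n. \<Sum>k<L. \<bar>?c k\<bar> / fact k * ?D k n) \<longlonglongrightarrow> (\<Sum>k<L. \<bar>?c k\<bar> / fact k * 0)"
      by (intro tendsto_sum tendsto_mult tendsto_const overlap_moment_tendsto)
    then have "eventually (\<lambda>n. (\<Sum>k<L. \<bar>?c k\<bar> / fact k * ?D k n) < e / 2) sequentially"
      using e by (intro order_tendstoD) auto
    then show "eventually (\<lambda>n. ?q n < e) sequentially"
      using eventually_ge_at_top[of 2] eventually_ge_at_top[of L]
    proof eventually_elim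
      case (elim n)
      show ?case
        using iid_edge_weights.expectation_pair_avg_poisson_le(1)[of "M n" n "Y n" a f B L, OF iid[OF elim(2)] B elim(3)]
          elim(1) L
        unfolding r_def p_def by linarith
    qed
  qed
qed

lemma quotient_conv_in_prob:
  assumes B: "\<And>m. \<bar>f m\<bar> \<le> B"
    and J_meas: "\<And>n. J n \<in> borel_measurable (M n)"
    and J: "\<And>n. 2 \<le> n \<Longrightarrow> AE x in M n. iid_edge_weights.ext_avg n (Y n) {} x \<noteq> 0 \<longrightarrow>
      J n x * iid_edge_weights.ext_avg n (Y n) {} x ^ 2 = iid_edge_weights.pair_avg n (Y n) f x"
  shows "conv_in_prob M J (measure_pmf.expectation (poisson_pmf (a 2)) f)"
proof -
  interpret iid_edge_weights "M 2" 2 "Y 2" a by (rule iid) simp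
  define p where "p = measure_pmf.expectation (poisson_pmf (a 2)) f"
  let ?l2_error = "\<lambda>n k. iid_edge_weights.l2_error n a k"
  let ?q = "\<lambda>n. \<integral>x. \<bar>iid_edge_weights.pair_avg n (Y n) f x -
     p * iid_edge_weights.ext_avg n (Y n) {} x ^ 2\<bar> \<partial>M n"
  have "(\<lambda>n. measure (M n) {x \<in> space (M n). e < \<bar>J n x - p\<bar>}) \<longlonglongrightarrow> 0" (is "?P \<longlonglongrightarrow> 0")
    if e: "0 < e" for e
  proof (rule order_tendstoI)
    fix d :: real assume "d < 0"
    moreover have "0 \<le> ?P n" for n by simp
    ultimately show "eventually (\<lambda>n. d < ?P n) sequentially"
      by (intro always_eventually allI) (rule less_le_trans)
  next
    fix d :: real assume d: "0 < d"
    \<comment> \<open>Makes the contribution of the inverse moment equal to \<open>d / 2\<close> for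
      every \<open>n\<close>; the other terms vanish in the limit for this fixed \<delta>.\<close>
    define \<delta> where "\<delta> = d / (4 * exp (2 * var))"
    have \<delta>: "0 < \<delta>" "2 * \<delta> * exp (2 * var) = d / 2" using d by (auto simp: \<delta>_def)
    have "(\<lambda>n. ?l2_error n 0 / \<delta> ^ 2 + ?q n / (e * \<delta> ^ 2)) \<longlonglongrightarrow> 0 / \<delta> ^ 2 + 0 / (e * \<delta> ^ 2)"
      unfolding p_def using e \<delta>(1)
      by (intro tendsto_add tendsto_divide tendsto_const l2_error_tendsto
          pair_avg_poisson_tendsto[of f B, OF B]) auto
    then have "eventually (\<lambda>n. ?l2_error n 0 / \<delta> ^ 2 + ?q n / (e * \<delta> ^ 2) < d / 2) sequentially"
      using d by (intro order_tendstoD) auto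
    then show "eventually (\<lambda>n. ?P n < d) sequentially"
      using eventually_ge_at_top[of 2]
    proof eventually_elim
      case (elim n)
      have "integrable (M n) (\<lambda>x. iid_edge_weights.pair_avg n (Y n) f x -
          p * iid_edge_weights.ext_avg n (Y n) {} x ^ 2)"
        unfolding p_def
        by (rule iid_edge_weights.expectation_pair_avg_poisson_le(2)[of "M n" n "Y n" a f B 0, OF iid[OF elim(2)] B]) simp
      from iid_edge_weights.prob_quotient_deviation_le[OF iid[OF elim(2)] J_meas J[OF elim(2)] this \<delta>(1) e]
      show ?case using elim(1) \<delta>(2) by linarith
    qed
  qed
  then show ?thesis unfolding conv_in_prob_def p_def using J_meas by auto
qed

end

section \<open>The Gibbs measure\<close>

lemma expectation_overlap_law:
  fixes f :: "nat \<Rightarrow> real"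
  shows "measure_pmf.expectation (overlap_law n \<beta> w) f =
    (\<Sum>\<pi>\<in>perfect_matchings n. \<Sum>\<pi>'\<in>perfect_matchings n.
      f (card (\<pi> \<inter> \<pi>')) * (pmf (gibbs n \<beta> w) \<pi> * pmf (gibbs n \<beta> w) \<pi>'))"
proof -
  let ?P = "perfect_matchings n" and ?G = "gibbs n \<beta> w"
  have "measure_pmf.expectation (overlap_law n \<beta> w) f =
      measure_pmf.expectation (pair_pmf ?G ?G) (\<lambda>(\<pi>, \<pi>'). f (card (\<pi> \<inter> \<pi>')))"
    unfolding overlap_law_def by (simp add: integral_map_pmf case_prod_unfold)
  also have "\<dots> = (\<Sum>z\<in>?P \<times> ?P. pmf (pair_pmf ?G ?G) z *\<^sub>R (case z of (\<pi>, \<pi>') \<Rightarrow> f (card (\<pi> \<inter> \<pi>'))))"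
    by (rule integral_measure_pmf)
      (auto simp: finite_perfect_matchings set_pmf_iff pmf_gibbs split: if_splits)
  also have "\<dots> = (\<Sum>\<pi>\<in>?P. \<Sum>\<pi>'\<in>?P. f (card (\<pi> \<inter> \<pi>')) * (pmf ?G \<pi> * pmf ?G \<pi>'))"
    unfolding sum.cartesian_product by (intro sum.cong refl) (auto simp: pmf_pair mult.commute)
  finally show ?thesis .
qed

lemma measurable_boltzmann [measurable]: "boltzmann \<beta> \<in> borel_measurable borel"
  unfolding boltzmann_def by measurable

lemma boltzmann_nonneg: "0 \<le> boltzmann \<beta> w"
  by (simp add: boltzmann_def)

text \<open>The exponent has to be positive: at an infinite weight \<open>boltzmann 0\<close> is 0,
  whereas a zeroth power is 1.\<close>

lemma boltzmann_power: "0 < j \<Longrightarrow> boltzmann \<beta> w ^ j = boltzmann (real j * \<beta>) w"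
  by (simp add: boltzmann_def zero_power flip: exp_of_nat_mult)

text \<open>Required by \<open>conv_in_prob\<close>; the expectation is a finite sum over atoms of
  the Gibbs measure, each measurable in the weights.\<close>

lemma measurable_expectation_overlap_law:
  fixes f :: "nat \<Rightarrow> real"
  assumes w: "\<And>e. e \<in> edges n \<Longrightarrow> w e \<in> borel_measurable M"
  shows "(\<lambda>x. measure_pmf.expectation (overlap_law n \<beta> (\<lambda>e. w e x)) f) \<in> borel_measurable M"
proof -
  have T: "(\<lambda>x. boltzmann \<beta> (total_weight (\<lambda>e. w e x) \<pi>)) \<in> borel_measurable M"
    if "\<pi> \<in> perfect_matchings n" for \<pi>
  proof -
    have "(\<lambda>x. total_weight (\<lambda>e. w e x) \<pi>) \<in> borel_measurable M"
      unfolding total_weight_def using that w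
      by (intro borel_measurable_ereal_sum) (auto simp: perfect_matchings_def)
    then show ?thesis by measurable
  qed
  have [measurable]: "(\<lambda>x. partition_fun n \<beta> (\<lambda>e. w e x)) \<in> borel_measurable M"
    unfolding partition_fun_def using T by (intro borel_measurable_times borel_measurable_sum) auto
  have "(\<lambda>x. pmf (gibbs n \<beta> (\<lambda>e. w e x)) \<pi>) \<in> borel_measurable M" if "\<pi> \<in> perfect_matchings n" for \<pi>
    unfolding pmf_gibbs using T[OF that] that by simp
  then show ?thesis unfolding expectation_overlap_law
    by (intro borel_measurable_sum borel_measurable_times) auto
qed

lemma boltzmann_total_weight:
  assumes "finite S" "\<And>e. e \<in> S \<Longrightarrow> w e \<noteq> -\<infinity>"
  shows "boltzmann \<beta> (total_weight w S) = (\<Prod>e\<in>S. boltzmann \<beta> (w e))"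
proof -
  \<comment> \<open>The second conjunct strengthens the induction: the exponential law is applied to
    the new weight and the partial sum, and both must differ from -infinity.\<close>
  have "boltzmann \<beta> (total_weight w S) = (\<Prod>e\<in>S. boltzmann \<beta> (w e)) \<and> total_weight w S \<noteq> -\<infinity>"
    using assms
  proof (induction S rule: finite_induct)
    case empty
    then show ?case by (simp add: boltzmann_def total_weight_def)
  next
    case (insert e S)
    have add: "boltzmann \<beta> (u + v) = boltzmann \<beta> u * boltzmann \<beta> v \<and> u + v \<noteq> -\<infinity>"
      if "u \<noteq> -\<infinity>" "v \<noteq> -\<infinity>" for u v :: ereal
      using that by (cases u; cases v) (auto simp: boltzmann_def distrib_left simp flip: exp_add)
    have "total_weight w (insert e S) = w e + total_weight w S"
      using insert by (simp add: total_weight_def)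
    then show ?case using insert add[of "w e" "total_weight w S"] by simp
  qed
  then show ?thesis ..
qed

theorem theorem1p2:
  fixes M :: "nat \<Rightarrow> 'a measure"
    and \<omega> :: "nat \<Rightarrow> nat \<times> nat \<Rightarrow> 'a \<Rightarrow> ereal"
    and \<mu> :: "ereal measure"
    and \<beta> :: real
  assumes "\<And>n. prob_space (M n)"
    and "\<And>n. prob_space.indep_vars (M n) (\<lambda>_. borel) (\<omega> n) (edges n)"
    and "\<And>n e. e \<in> edges n \<Longrightarrow> distr (M n) borel (\<omega> n e) = \<mu>"
    and "AE w in \<mu>. w \<noteq> -\<infinity>"
    and "\<not> (AE w in \<mu>. w = \<infinity>)"
    and "\<And>b. b \<ge> 0 \<Longrightarrow> integrable \<mu> (boltzmann b)"
    and "\<beta> \<ge> 0"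
  shows "weak_conv_in_prob M
           (\<lambda>n x. measure_pmf (overlap_law n \<beta> (\<lambda>e. \<omega> n e x)))
           (measure_pmf (poisson_pmf (exp (log_mgf \<mu> (2 * \<beta>) - 2 * log_mgf \<mu> \<beta>))))"
proof -
  have meas: "\<omega> n e \<in> borel_measurable (M n)" if "e \<in> edges n" for n e
    using assms(2)[of n] that by (simp add: prob_space.indep_vars_def[OF assms(1)])
  define m where "m b = (\<integral>w. boltzmann b w \<partial>\<mu>)" for b
  \<comment> \<open>A vanishing mean would make the weight infinite almost surely.\<close>
  have m_pos: "0 < m b" if "0 \<le> b" for b
  proof -
    have "m b \<noteq> 0"
    proof
      assume "m b = 0"
      then have "AE w in \<mu>. boltzmann b w = 0"
        unfolding m_def using assms(6)[OF that] boltzmann_nonneg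
        by (subst (asm) integral_nonneg_eq_0_iff_AE) auto
      then have "AE w in \<mu>. w = \<infinity>"
        by eventually_elim (simp add: boltzmann_def split: if_splits)
      then show False using assms(5) by simp
    qed
    moreover have "0 \<le> m b" unfolding m_def by (intro integral_nonneg_AE AE_I2 boltzmann_nonneg)
    ultimately show ?thesis by simp
  qed
  define m1 where "m1 = m \<beta>"
  have m1: "0 < m1" unfolding m1_def using assms(7) by (rule m_pos)
  define Y where "Y n e x = boltzmann \<beta> (\<omega> n e x) / m1" for n e x
  \<comment> \<open>The case \<open>j = 0\<close> is separate because \<open>m 0\<close> is the
    probability of a finite weight, which may be below 1.\<close>
  define a where "a j = (if j = 0 then 1 else m (real j * \<beta>) / m1 ^ j)" for j
  have moments: "integrable (M n) (\<lambda>x. Y n e x ^ j) \<and> (\<integral>x. Y n e x ^ j \<partial>M n) = a j"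
    if e: "e \<in> edges n" for n e j
  proof (cases "j = 0")
    case True
    interpret prob_space "M n" by (rule assms(1))
    show ?thesis using True by (simp add: a_def prob_space)
  next
    case False
    have Y: "Y n e x ^ j = boltzmann (real j * \<beta>) (\<omega> n e x) / m1 ^ j" for x
      using False by (simp add: Y_def power_divide boltzmann_power)
    have "integrable (distr (M n) borel (\<omega> n e)) (boltzmann (real j * \<beta>))"
      using assms(3)[OF e] assms(6)[of "real j * \<beta>"] assms(7) by simp
    then have "integrable (M n) (\<lambda>x. boltzmann (real j * \<beta>) (\<omega> n e x))"
      by (subst (asm) integrable_distr_eq) (use meas[OF e] in auto)
    moreover have "(\<integral>x. boltzmann (real j * \<beta>) (\<omega> n e x) \<partial>M n) = m (real j * \<beta>)"
      unfolding m_def assms(3)[OF e, symmetric] using meas[OF e] by (subst integral_distr) auto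
    ultimately show ?thesis using False by (simp add: Y a_def)
  qed
  have iid: "iid_edge_weights (M n) n (Y n) a" if n: "2 \<le> n" for n
  proof -
    interpret prob_space "M n" by (rule assms(1))
    show ?thesis
    proof
      show "indep_vars (\<lambda>_. borel) (Y n) (edges n)"
        unfolding Y_def by (rule indep_vars_compose2[OF assms(2)]) measurable
      show "0 \<le> Y n e x" for e x using m1 by (simp add: Y_def boltzmann_nonneg)
      show "a 1 = 1" using m1 by (simp add: a_def m1_def)
    qed (use moments n in auto)
  qed
  have a2: "a 2 = exp (log_mgf \<mu> (2 * \<beta>) - 2 * log_mgf \<mu> \<beta>)"
  proof -
    have "0 < m (2 * \<beta>)" using m_pos assms(7) by simp
    moreover have "exp (2 * ln m1) = m1 ^ 2" using m1 by (simp add: exp_double)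
    ultimately show ?thesis using m1 by (simp add: a_def log_mgf_def exp_diff m1_def flip: m_def)
  qed
  \<comment> \<open>The factor \<open>m1 ^ n\<close> cancels in the Gibbs probabilities, so the
    normalised weights give the same measure. The restriction to almost every \<open>x\<close>
    excludes weights -infinity, as the product formula for \<open>boltzmann\<close>
    requires.\<close>
  have identity: "AE x in M n. iid_edge_weights.ext_avg n (Y n) {} x \<noteq> 0 \<longrightarrow>
      measure_pmf.expectation (overlap_law n \<beta> (\<lambda>e. \<omega> n e x)) f * iid_edge_weights.ext_avg n (Y n) {} x ^ 2 =
      iid_edge_weights.pair_avg n (Y n) f x" if n: "2 \<le> n" for n and f :: "nat \<Rightarrow> real"
  proof -
    interpret iid_edge_weights "M n" n "Y n" a by (rule iid) fact
    have "AE x in M n. \<forall>e\<in>edges n. \<omega> n e x \<noteq> -\<infinity>"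
    proof (rule AE_finite_allI[OF finite_edges])
      fix e assume e: "e \<in> edges n"
      show "AE x in M n. \<omega> n e x \<noteq> -\<infinity>"
        using assms(4) unfolding assms(3)[OF e, symmetric]
        by (subst (asm) AE_distr_iff) (use meas[OF e] in auto)
    qed
    then show ?thesis
    proof eventually_elim
      case (elim x)
      let ?w = "\<lambda>e. \<omega> n e x" and ?Z = "ext_avg {} x"
      have W: "boltzmann \<beta> (total_weight ?w \<pi>) = m1 ^ n * weight \<pi> x" if "\<pi> \<in> perfect_matchings n" for \<pi>
      proof -
        note \<pi> = card_perfect_matching[OF that]
        have "boltzmann \<beta> (total_weight ?w \<pi>) = (\<Prod>e\<in>\<pi>. m1 * Y n e x)"
          using elim perfect_matching_edges[OF that] m1 \<pi>(1)
          by (subst boltzmann_total_weight) (auto simp: Y_def)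
        then show ?thesis using \<pi>(2) by (simp add: weight_def prod.distrib)
      qed
      have Z: "partition_fun n \<beta> ?w = m1 ^ n * ?Z"
        by (simp add: partition_fun_def ext_avg_def W sum_distrib_left sum_divide_distrib)
      show ?case
      proof
        assume "?Z \<noteq> 0"
        then have "pmf (gibbs n \<beta> ?w) \<pi> = weight \<pi> x / (fact n * ?Z)" if "\<pi> \<in> perfect_matchings n" for \<pi>
          using that m1 by (simp add: pmf_gibbs Z W)
        then have "measure_pmf.expectation (overlap_law n \<beta> ?w) f =
            (\<Sum>\<pi>\<in>perfect_matchings n. \<Sum>\<pi>'\<in>perfect_matchings n.
              f (card (\<pi> \<inter> \<pi>')) * (weight \<pi> x * weight \<pi>' x) / (fact n * ?Z) ^ 2)"
          unfolding expectation_overlap_law by (intro sum.cong refl) (simp add: power2_eq_square)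
        also have "\<dots> = pair_avg f x / ?Z ^ 2"
          by (simp add: pair_avg_def power_mult_distrib flip: sum_divide_distrib)
        finally show "measure_pmf.expectation (overlap_law n \<beta> ?w) f * ?Z ^ 2 = pair_avg f x"
          using \<open>?Z \<noteq> 0\<close> by simp
      qed
    qed
  qed
  show ?thesis
    unfolding weak_conv_in_prob_def
  proof (intro allI impI)
    fix f :: "nat \<Rightarrow> real"
    assume "continuous_on UNIV f \<and> bounded (range f)"
    then obtain B where B: "\<bar>f k\<bar> \<le> B" for k by (auto simp: bounded_iff)
    show "conv_in_prob M (\<lambda>n x. measure_pmf.expectation (overlap_law n \<beta> (\<lambda>e. \<omega> n e x)) f)
       (measure_pmf.expectation (poisson_pmf (exp (log_mgf \<mu> (2 * \<beta>) - 2 * log_mgf \<mu> \<beta>))) f)"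
      unfolding a2[symmetric]
      by (rule quotient_conv_in_prob[of M Y a f B, OF iid B measurable_expectation_overlap_law[OF meas] identity])
  qed
qed

end
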